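(* Let $\Sigma$ be a polyhedral fan in $\mathbb{R}^d$ with face poset $\mathcal{F}(\Sigma)$, let $\mathcal{G}\subseteq\mathcal{F}(\Sigma)\setminus\{\{0\}\}$ be a building set of $\mathcal{F}(\Sigma)$, and let $\mathcal{N}(\mathcal{G})$ be the simplicial complex of nested sets in $\mathcal{G}$. Then the consecutive application of stellar subdivisions in every cone $G\in\mathcal{G}$, in a non-increasing order (i.e. if $G\supsetneq G'$ then the subdivision in $G$ is performed before the one in $G'$), yields a simplicial subdivision of $\Sigma$ whose face poset is equal to the face poset of $\mathcal{N}(\mathcal{G})$.
   Context: A polyhedral fan $\Sigma$ is a finite collection of closed (pointed) polyhedral cones in $\mathbb{R}^d$ closed under taking faces and such that the intersection of any two is a common face of both (in particular a cone in $\Sigma$). $\mathcal{F}(\Sigma)$ is the set of cones of $\Sigma$ ordered by inclusion, with the zero cone $\{0\}$ as minimal element $\hat 0$; it is a meet-semilattice. Stellar subdivision: for $\tau\in\Sigma$ and $x$ in the relative interior of $\tau$, put $\mathrm{star}(\tau,\Sigma)=\{\sigma\in\Sigma:\tau\subseteq\sigma\}$. The stellar subdivision of $\Sigma$ in $x$ (also called a stellar subdivision in $\tau$) is the collection of cones $(\Sigma\setminus\mathrm{star}(\tau,\Sigma))\cup\{\mathrm{cone}(x,\rho):\rho\in\Sigma\setminus\mathrm{star}(\tau,\Sigma),\ \rho\subseteq\sigma\text{ for some }\sigma\in\mathrm{star}(\tau,\Sigma)\}$, where $\mathrm{cone}(x,\rho)$ is the closed polyhedral cone spanned by $\rho$ and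 $x$. Its face poset does not depend on the choice of $x$ in the relative interior of $\tau$. Building set of a finite meet-semilattice $\mathcal{L}$: a subset $\mathcal{G}\subseteq\mathcal{L}\setminus\{\hat 0\}$ such that for every $x\in\mathcal{L}\setminus\{\hat 0\}$, with $\{x_1,\dots,x_k\}$ the set of maximal elements of $\{g\in\mathcal{G}:g\le x\}$, there is a poset isomorphism $\varphi_x:\prod_{j=1}^k[\hat 0,x_j]\to[\hat 0,x]$ with $\varphi_x(\hat 0,\dots,x_j,\dots,\hat 0)=x_j$ for all $j$. Nested set: $N\subseteq\mathcal{G}$ such that for any pairwise incomparable $x_1,\dots,x_t\in N$, $t\ge2$, the join $x_1\vee\dots\vee x_t$ exists in $\mathcal{L}$ and is not in $\mathcal{G}$. The nested sets form the abstract simplicial complex $\mathcal{N}(\mathcal{G})$; its face poset includes the empty face. *)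

theory Defs
  imports "HOL-Analysis.Analysis"
begin

section \<open>Finite posets\<close>

text \<open>A poset is given by a carrier set \<open>L\<close> in a type of class \<open>order\<close>, ordered by the
  ambient \<open>\<le>\<close>. For sets of sets (fans, simplicial complexes) this is inclusion, so a fan is
  its own face poset; for functions it is the componentwise order.\<close>

definition poset_iso :: "('p::order \<Rightarrow> 'q::order) \<Rightarrow> 'p set \<Rightarrow> 'q set \<Rightarrow> bool" where
  "poset_iso f P Q \<longleftrightarrow> bij_betw f P Q \<and> (\<forall>x\<in>P. \<forall>y\<in>P. x \<le> y \<longleftrightarrow> f x \<le> f y)"

definition bottom :: "'p::order set \<Rightarrow> 'p" where
  "bottom L = (LEAST b. b \<in> L)"

text \<open>The interval from the bottom element of \<open>L\<close> to \<open>x\<close>.\<close>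

definition lower_interval :: "'p::order set \<Rightarrow> 'p \<Rightarrow> 'p set" where
  "lower_interval L x = {z \<in> L. z \<le> x}"

definition maximal_elements :: "'p::order set \<Rightarrow> 'p set" where
  "maximal_elements S = {x \<in> S. \<forall>y\<in>S. \<not> x < y}"

definition is_join :: "'p::order set \<Rightarrow> 'p set \<Rightarrow> 'p \<Rightarrow> bool" where
  "is_join L A j \<longleftrightarrow> j \<in> L \<and> (\<forall>a\<in>A. a \<le> j) \<and> (\<forall>u\<in>L. (\<forall>a\<in>A. a \<le> u) \<longrightarrow> j \<le> u)"

section \<open>Building sets and nested sets\<close>

text \<open>Only meaningful if \<open>L\<close> is a finite meet-semilattice. The product of the intervals below
  the \<open>y \<in> X\<close> is the set of extensional functions on \<open>X\<close>; outside \<open>X\<close> they all agree, so the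
  pointwise order on them is the product order.\<close>

definition building_set :: "'p::order set \<Rightarrow> 'p set \<Rightarrow> bool" where
  "building_set L \<G> \<longleftrightarrow>
     \<G> \<subseteq> L - {bottom L} \<and>
     (\<forall>x \<in> L - {bottom L}. let X = maximal_elements {g \<in> \<G>. g \<le> x} in
        \<exists>\<phi>. poset_iso \<phi> (\<Pi>\<^sub>E y\<in>X. lower_interval L y) (lower_interval L x) \<and>
            (\<forall>y\<in>X. \<phi> (\<lambda>z\<in>X. if z = y then y else bottom L) = y))"

definition nested_set :: "'p::order set \<Rightarrow> 'p set \<Rightarrow> 'p set \<Rightarrow> bool" where
  "nested_set L \<G> N \<longleftrightarrow>
     N \<subseteq> \<G> \<and>
     (\<forall>A \<subseteq> N. finite A \<and> card A \<ge> 2 \<and> pairwise (\<lambda>x y. \<not> x \<le> y) A \<longrightarrow>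
        (\<exists>j. is_join L A j \<and> j \<notin> \<G>))"

definition nested_complex :: "'p::order set \<Rightarrow> 'p set \<Rightarrow> 'p set set" where
  "nested_complex L \<G> = {N. nested_set L \<G> N}"

section \<open>Polyhedral fans\<close>

definition pointed_polyhedral_cone :: "'a::euclidean_space set \<Rightarrow> bool" where
  "pointed_polyhedral_cone C \<longleftrightarrow> polyhedron C \<and> convex_cone C \<and> C \<inter> uminus ` C = {0}"

text \<open>Every set has \<open>{}\<close> as a face in the sense of \<open>face_of\<close>; it is not a face of a cone.\<close>

definition polyhedral_fan :: "'a::euclidean_space set set \<Rightarrow> bool" where
  "polyhedral_fan \<Sigma> \<longleftrightarrow>
     finite \<Sigma> \<and> {0} \<in> \<Sigma> \<and>
     (\<forall>\<sigma>\<in>\<Sigma>. pointed_polyhedral_cone \<sigma>) \<and>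
     (\<forall>\<sigma>\<in>\<Sigma>. \<forall>\<rho>. \<rho> face_of \<sigma> \<and> \<rho> \<noteq> {} \<longrightarrow> \<rho> \<in> \<Sigma>) \<and>
     (\<forall>\<sigma>\<in>\<Sigma>. \<forall>\<tau>\<in>\<Sigma>. \<sigma> \<inter> \<tau> face_of \<sigma> \<and> \<sigma> \<inter> \<tau> face_of \<tau>)"

definition simplicial_cone :: "'a::euclidean_space set \<Rightarrow> bool" where
  "simplicial_cone C \<longleftrightarrow> (\<exists>B. independent B \<and> C = convex_cone hull B)"

definition fan_subdivision :: "'a::euclidean_space set set \<Rightarrow> 'a set set \<Rightarrow> bool" where
  "fan_subdivision \<Sigma>' \<Sigma> \<longleftrightarrow>
     polyhedral_fan \<Sigma>' \<and> polyhedral_fan \<Sigma> \<and>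
     (\<forall>\<sigma>'\<in>\<Sigma>'. \<exists>\<sigma>\<in>\<Sigma>. \<sigma>' \<subseteq> \<sigma>) \<and> \<Union>\<Sigma>' = \<Union>\<Sigma>"

definition simplicial_subdivision :: "'a::euclidean_space set set \<Rightarrow> 'a set set \<Rightarrow> bool" where
  "simplicial_subdivision \<Sigma>' \<Sigma> \<longleftrightarrow> fan_subdivision \<Sigma>' \<Sigma> \<and> (\<forall>\<sigma>'\<in>\<Sigma>'. simplicial_cone \<sigma>')"

section \<open>Stellar subdivisions\<close>

definition fan_star :: "'a set \<Rightarrow> 'a set set \<Rightarrow> 'a set set" where
  "fan_star \<tau> \<Sigma> = {\<sigma> \<in> \<Sigma>. \<tau> \<subseteq> \<sigma>}"

text \<open>Meant for \<open>\<tau> \<in> \<Sigma>\<close> and \<open>x \<in> rel_interior \<tau>\<close>.\<close>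

definition stellar_subdivision ::
    "'a::euclidean_space set set \<Rightarrow> 'a set \<Rightarrow> 'a \<Rightarrow> 'a set set" where
  "stellar_subdivision \<Sigma> \<tau> x =
     (\<Sigma> - fan_star \<tau> \<Sigma>) \<union>
     {convex_cone hull (insert x \<rho>) |\<rho>. \<rho> \<in> \<Sigma> - fan_star \<tau> \<Sigma> \<and> (\<exists>\<sigma>\<in>fan_star \<tau> \<Sigma>. \<rho> \<subseteq> \<sigma>)}"

text \<open>Subdivide successively in the cones of the list, the head of the list first, using the
  point \<open>x G\<close> for the cone \<open>G\<close>.\<close>

definition iterated_stellar ::
    "('a::euclidean_space set \<Rightarrow> 'a) \<Rightarrow> 'a set set \<Rightarrow> 'a set list \<Rightarrow> 'a set set" where
  "iterated_stellar x \<Sigma> Gs = foldl (\<lambda>\<Delta> G. stellar_subdivision \<Delta> G (x G)) \<Sigma> Gs"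

end

theory Submission
  imports Defs
begin

text \<open>Every cone that arises during the subdivision process is spanned by a cone \<open>s\<close> of the
  original fan together with the points \<open>x G\<close>, \<open>G \<in> N\<close>, for a set \<open>N\<close> of cones already
  treated, and inclusion of such cones is componentwise inclusion of the pairs \<open>(N, s)\<close>. The pairs
  that occur are governed by joins in \<open>\<Sigma>\<close>: for each treated \<open>G\<close>, the join of \<open>s\<close> with the
  members of \<open>N\<close> treated after \<open>G\<close> exists and does not contain \<open>G\<close>. This needs nothing
  about building sets. After the last step, the condition forces \<open>s = {0}\<close> and makes \<open>N\<close>
  nested. Conversely, if \<open>N\<close> is nested, the product decomposition below its join shows that every
  element of \<open>\<G>\<close> below the join lies below a member of \<open>N\<close>; since larger cones are
  treated first, the condition holds for all such \<open>N\<close>.\<close>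

section \<open>Convex cones\<close>

lemma convex_cone_face:
  assumes "convex_cone C" "F face_of C" "F \<noteq> {}"
  shows "convex_cone F"
  using assms face_of_conic face_of_imp_convex unfolding convex_cone_def by blast

text \<open>Scaling trades segments for sums: \<open>a + b\<close> is the midpoint of
  \<open>2 *\<^sub>R a\<close> and \<open>2 *\<^sub>R b\<close>, and conversely both terms of a
  convex combination of points of \<open>C\<close> are again in \<open>C\<close>.\<close>

lemma face_of_convex_cone_iff:
  assumes C: "convex_cone C" and F: "convex_cone F"
  shows "F face_of C \<longleftrightarrow> F \<subseteq> C \<and> (\<forall>a\<in>C. \<forall>b\<in>C. a + b \<in> F \<longrightarrow> a \<in> F \<and> b \<in> F)"
proof (intro iffI conjI ballI impI)
  assume face: "F face_of C"
  show "F \<subseteq> C"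
    using face face_of_imp_subset by blast
  have left: "a \<in> F" if ab: "a \<in> C" "b \<in> C" "a + b \<in> F" for a b
  \<comment> \<open>An open segment from a point to itself is empty, so equal summands are obtained
    by halving \<open>a + b\<close> instead.\<close>
  proof (cases "a = b")
    case True
    then have "(1/2) *\<^sub>R (a + b) = a"
      by (simp flip: scaleR_2)
    then show ?thesis
      using convex_cone_scaleR[OF F, of "1/2" "a + b"] ab by simp
  next
    case False
    have mem: "2 *\<^sub>R a \<in> C" "2 *\<^sub>R b \<in> C"
      using convex_cone_scaleR[OF C] ab by auto
    have "a + b \<in> open_segment (2 *\<^sub>R a) (2 *\<^sub>R b)"
      using False by (auto simp: in_segment intro!: exI[of _ "1/2"])
    then have "2 *\<^sub>R a \<in> F"
      using face_ofD[OF face _ mem] ab by blast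
    then show ?thesis
      using convex_cone_scaleR[OF F, of "1/2" "2 *\<^sub>R a"] by simp
  qed
  fix a b assume "a \<in> C" "b \<in> C" "a + b \<in> F"
  then show "a \<in> F" "b \<in> F"
    using left[of a b] left[of b a] by (simp_all add: add.commute)
next
  assume R: "F \<subseteq> C \<and> (\<forall>a\<in>C. \<forall>b\<in>C. a + b \<in> F \<longrightarrow> a \<in> F \<and> b \<in> F)"
  show "F face_of C"
    unfolding face_of_def
  proof (intro conjI ballI impI)
    show "F \<subseteq> C" "convex F"
      using R F by (auto simp: convex_cone_def)
    fix a b y assume ab: "a \<in> C" "b \<in> C" and y: "y \<in> F" "y \<in> open_segment a b"
    obtain u where u: "0 < u" "u < 1" "y = (1 - u) *\<^sub>R a + u *\<^sub>R b"
      using y(2) by (auto simp: in_segment)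
    have "(1 - u) *\<^sub>R a \<in> C" "u *\<^sub>R b \<in> C"
      using u ab convex_cone_scaleR[OF C] by auto
    with R y(1) u(3) have *: "(1 - u) *\<^sub>R a \<in> F" "u *\<^sub>R b \<in> F"
      by auto
    show "a \<in> F" "b \<in> F"
      using convex_cone_scaleR[OF F _ *(1), of "1 / (1 - u)"]
        convex_cone_scaleR[OF F _ *(2), of "1 / u"] u by auto
  qed
qed

section \<open>Adjoining a ray to a cone\<close>

lemma mem_convex_cone_hull_insert:
  assumes "convex_cone R"
  shows "y \<in> convex_cone hull (insert x R) \<longleftrightarrow> (\<exists>t\<ge>0. \<exists>r\<in>R. y = t *\<^sub>R x + r)"
proof -
  have "convex_cone hull R = R"
    by (simp add: assms hull_same)
  moreover have "convex_cone hull {x} = {t *\<^sub>R x |t. 0 \<le> t}"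
    by (auto simp: convex_cone_hull_convex_hull_nonempty)
  ultimately have "convex_cone hull ({x} \<union> R) = (\<Union>p\<in>{t *\<^sub>R x |t. 0 \<le> t}. \<Union>y\<in>R. {p + y})"
    by (simp only: convex_cone_hull_Un)
  then show ?thesis
    by auto
qed

text \<open>The assumptions say that \<open>x\<close> is not in the span of \<open>R\<close>; \<open>a \<bullet> y\<close> is the coordinate
  of \<open>y\<close> along \<open>x\<close>.\<close>

locale cone_extension =
  fixes R :: "'a::euclidean_space set" and x a :: 'a
  assumes cone: "pointed_polyhedral_cone R"
    and orth: "\<And>r. r \<in> R \<Longrightarrow> a \<bullet> r = 0"
    and height: "a \<bullet> x = 1"
begin

abbreviation "C \<equiv> convex_cone hull (insert x R)"

lemma convex_cone_R: "convex_cone R"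
  using cone by (simp add: pointed_polyhedral_cone_def)

lemmas mem_C = mem_convex_cone_hull_insert[OF convex_cone_R]

lemma convex_cone_C: "convex_cone C"
  by (rule convex_cone_convex_cone_hull)

lemma x_in_C: "x \<in> C"
  by (simp add: hull_inc)

lemma R_subset_C: "R \<subseteq> C"
  by (meson hull_subset insert_subset)

lemma height_C: "y \<in> C \<Longrightarrow> 0 \<le> a \<bullet> y"
  using mem_C orth height by (auto simp: inner_simps)

lemma base_iff: "y \<in> R \<longleftrightarrow> y \<in> C \<and> a \<bullet> y = 0"
  using mem_C orth height R_subset_C by (auto simp: inner_simps)

lemma base_face: "R face_of C"
  unfolding face_of_convex_cone_iff[OF convex_cone_C convex_cone_R]
  using height_C base_iff R_subset_C
  by (auto simp: inner_simps) (metis add_nonneg_eq_0_iff)+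

text \<open>A face containing \<open>t *\<^sub>R x + r\<close> contains both terms. If it contains
  \<open>x\<close>, it is recovered from its trace on \<open>R\<close>; otherwise no positive
  multiple of \<open>x\<close> lies in it, so it lies in \<open>R\<close>.\<close>

lemma face_of_extension:
  assumes "K face_of C" "K \<noteq> {}"
  shows "K face_of R \<or> (\<exists>F. F face_of R \<and> F \<noteq> {} \<and> K = convex_cone hull (insert x F))"
proof -
  have K: "convex_cone K"
    using convex_cone_face assms convex_cone_C by blast
  have Kadd: "u \<in> K" "v \<in> K" if "u \<in> C" "v \<in> C" "u + v \<in> K" for u v
    using face_of_convex_cone_iff[OF convex_cone_C K] assms(1) that by blast+
  have KC: "K \<subseteq> C"
    using assms(1) face_of_imp_subset by blast
  have split: "t *\<^sub>R x \<in> K" "r \<in> K" if "t *\<^sub>R x + r \<in> K" "0 \<le> t" "r \<in> R" for t r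
    using Kadd[of "t *\<^sub>R x" r] that R_subset_C x_in_C convex_cone_scaleR[OF convex_cone_C] by auto
  have face: "K \<inter> R face_of R"
    by (rule face_of_subset[of _ C])
      (use assms(1) base_face face_of_Int R_subset_C in auto)
  have ne: "K \<inter> R \<noteq> {}"
    using convex_cone_contains_0 K convex_cone_R by blast
  show ?thesis
  proof (cases "x \<in> K")
    case True
    have "K = convex_cone hull (insert x (K \<inter> R))"
    proof
      show "K \<subseteq> convex_cone hull (insert x (K \<inter> R))"
        using KC mem_C split mem_convex_cone_hull_insert[OF convex_cone_face[OF convex_cone_R face ne]]
        by (smt (verit) IntI subset_iff)
      show "convex_cone hull (insert x (K \<inter> R)) \<subseteq> K"
        by (rule hull_minimal) (use True K in auto)
    qed
    then show ?thesis
      using face ne by blast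
  next
    case False
    have "K \<subseteq> R"
    proof
      fix y assume y: "y \<in> K"
      then obtain t r where t: "0 \<le> t" "r \<in> R" "y = t *\<^sub>R x + r"
        using KC mem_C by blast
      then have "t *\<^sub>R x \<in> K"
        using split y by blast
      then have "t = 0"
        using convex_cone_scaleR[OF K, of "1 / t" "t *\<^sub>R x"] False t(1) by (cases "t = 0") auto
      with t show "y \<in> R"
        by simp
    qed
    then show ?thesis
      using face by (simp add: Int_absorb2)
  qed
qed

text \<open>Taking the inner product with \<open>a\<close> reads off the coefficients of
  \<open>x\<close>. These add up on both sides of the equation for \<open>u + v\<close>, so
  \<open>x\<close> cancels and only the face condition of \<open>F\<close> in \<open>R\<close> is
  left.\<close>

lemma extension_face:
  assumes F: "F face_of R" "F \<noteq> {}"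
  shows "convex_cone hull (insert x F) face_of C"
proof -
  have cF: "convex_cone F"
    using convex_cone_face convex_cone_R F by blast
  have FR: "F \<subseteq> R"
    using F(1) face_of_imp_subset by blast
  have Fadd: "u \<in> F \<and> v \<in> F" if "u \<in> R" "v \<in> R" "u + v \<in> F" for u v
    using face_of_convex_cone_iff[OF convex_cone_R cF] F(1) that by blast
  show ?thesis
    unfolding face_of_convex_cone_iff[OF convex_cone_C convex_cone_convex_cone_hull]
  proof (intro conjI ballI impI)
    show "convex_cone hull (insert x F) \<subseteq> C"
      by (intro hull_mono insert_mono FR)
    fix u v assume uv: "u \<in> C" "v \<in> C" "u + v \<in> convex_cone hull (insert x F)"
    obtain s p where s: "0 \<le> s" "p \<in> R" "u = s *\<^sub>R x + p"
      using uv mem_C by blast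
    obtain t q where t: "0 \<le> t" "q \<in> R" "v = t *\<^sub>R x + q"
      using uv mem_C by blast
    obtain w r where w: "0 \<le> w" "r \<in> F" "u + v = w *\<^sub>R x + r"
      using uv mem_convex_cone_hull_insert[OF cF] by blast
    have "a \<bullet> (u + v) = s + t"
      unfolding s t using s(2) t(2) orth height by (simp add: inner_simps)
    moreover have "a \<bullet> (u + v) = w"
      unfolding w using w(2) orth height FR by (auto simp: inner_simps)
    moreover have "w *\<^sub>R x + r = (s + t) *\<^sub>R x + (p + q)"
      unfolding w(3)[symmetric] s t by (simp add: algebra_simps)
    ultimately have "p + q = r"
      by simp
    then have "p \<in> F" "q \<in> F"
      using Fadd w s t by auto
    then show "u \<in> convex_cone hull (insert x F)" "v \<in> convex_cone hull (insert x F)"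
      using s t mem_convex_cone_hull_insert[OF cF] by blast+
  qed
qed

lemma pointed_polyhedral_cone_extension: "pointed_polyhedral_cone C"
  unfolding pointed_polyhedral_cone_def
proof (intro conjI)
  have R: "closed R" "finite {F. F face_of R}"
    using cone polyhedron_eq_finite_faces unfolding pointed_polyhedral_cone_def by blast+
  show "polyhedron C"
    unfolding polyhedron_eq_finite_faces
  proof (intro conjI)
    \<comment> \<open>Projecting along \<open>x\<close> onto the hyperplane orthogonal to
      \<open>a\<close> describes \<open>C\<close> by closed conditions.\<close>
    have "C = {y. 0 \<le> a \<bullet> y} \<inter> (\<lambda>y. y - (a \<bullet> y) *\<^sub>R x) -` R"
    proof (intro set_eqI iffI)
      fix y assume "y \<in> {y. 0 \<le> a \<bullet> y} \<inter> (\<lambda>y. y - (a \<bullet> y) *\<^sub>R x) -` R"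
      then show "y \<in> C"
        unfolding mem_C
        by (intro exI[of _ "a \<bullet> y"] conjI bexI[of _ "y - (a \<bullet> y) *\<^sub>R x"]) auto
    qed (auto simp: mem_C orth height inner_simps)
    moreover have "closed ((\<lambda>y. y - (a \<bullet> y) *\<^sub>R x) -` R)"
      by (intro closed_vimage R continuous_intros)
    ultimately show "closed C"
      by (simp add: closed_Int closed_halfspace_ge)
    show "convex C"
      using convex_cone_C by (simp add: convex_cone_def)
    have "{F. F face_of C} \<subseteq>
        insert {} ({F. F face_of R} \<union> (\<lambda>F. convex_cone hull (insert x F)) ` {F. F face_of R})"
      using face_of_extension by blast
    then show "finite {F. F face_of C}"
      by (rule finite_subset) (simp add: R)
  qed
  show "convex_cone C"
    by (rule convex_cone_C)
  have "y = 0" if "y \<in> C" "- y \<in> C" for y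
  proof -
    have "a \<bullet> y = 0"
      using height_C[OF that(1)] height_C[OF that(2)] by simp
    then have "y \<in> R" "- y \<in> R"
      using that base_iff by auto
    then have "y \<in> R \<inter> uminus ` R"
      by (metis IntI image_eqI minus_minus)
    then show ?thesis
      using cone unfolding pointed_polyhedral_cone_def by blast
  qed
  then show "C \<inter> uminus ` C = {0}"
    using convex_cone_contains_0[OF convex_cone_C] by force
qed

lemma simplicial_cone_extension:
  assumes "simplicial_cone R"
  shows "simplicial_cone C"
proof -
  obtain B where B: "independent B" "R = convex_cone hull B"
    using assms simplicial_cone_def by blast
  have BR: "B \<subseteq> R"
    using B by (simp add: hull_subset)
  have "span B \<subseteq> {y. a \<bullet> y = 0}"
    by (rule span_minimal) (use BR orth in \<open>auto simp: subspace_hyperplane\<close>)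
  then have "x \<notin> span B"
    using height by auto
  then have "independent (insert x B)"
    using B by (simp add: independent_insert)
  moreover have "C = convex_cone hull (insert x B)"
  proof
    show "C \<subseteq> convex_cone hull (insert x B)"
      using B by (intro hull_minimal) (auto intro: hull_inc convex_cone_convex_cone_hull hull_mono[THEN subsetD])
    show "convex_cone hull (insert x B) \<subseteq> C"
      by (intro hull_mono insert_mono BR)
  qed
  ultimately show ?thesis
    unfolding simplicial_cone_def by blast
qed

end

text \<open>If arbitrarily large \<open>t\<close> occurred, dividing
  \<open>p - t *\<^sub>R x\<close> by \<open>t\<close> and passing to the limit would put
  \<open>- x\<close> into the closed cone, against pointedness.\<close>

lemma convex_cone_bounded_translates:
  fixes S :: "'a::real_normed_vector set"
  assumes S: "closed S" "convex_cone S" "S \<inter> uminus ` S = {0}" and x: "x \<in> S" "x \<noteq> 0"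
  shows "bounded {t. 0 \<le> t \<and> p - t *\<^sub>R x \<in> S}"
proof (rule ccontr)
  assume unb: "\<not> bounded {t. 0 \<le> t \<and> p - t *\<^sub>R x \<in> S}"
  have "\<exists>t>real n. p - t *\<^sub>R x \<in> S" for n :: nat
    using unb unfolding bounded_iff by (smt (verit) mem_Collect_eq of_nat_0_le_iff real_norm_def)
  then obtain t where t: "\<And>n::nat. t n > real n" "\<And>n. p - t n *\<^sub>R x \<in> S"
    by metis
  have pos: "t n > 0" for n
    using t(1)[of n] of_nat_0_le_iff[of n] by linarith
  have "(1 / t n) *\<^sub>R (p - t n *\<^sub>R x) \<in> S" for n
    using convex_cone_scaleR[OF S(2)] t(2) pos[of n] by simp
  moreover have "(1 / t n) *\<^sub>R (p - t n *\<^sub>R x) = (1 / t n) *\<^sub>R p - x" for n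
    using pos[of n] by (simp add: algebra_simps)
  ultimately have mem: "(1 / t n) *\<^sub>R p - x \<in> S" for n
    by metis
  have "filterlim t at_top sequentially"
    by (rule filterlim_at_top_mono[OF filterlim_real_sequentially])
      (intro always_eventually allI less_imp_le t(1))
  then have "(\<lambda>n. 1 / t n) \<longlonglongrightarrow> 0"
    by (intro real_tendsto_divide_at_top[OF tendsto_const])
  from tendsto_diff[OF tendsto_scaleR[OF this tendsto_const[of p]] tendsto_const[of x]]
  have "(\<lambda>n. (1 / t n) *\<^sub>R p - x) \<longlonglongrightarrow> - x"
    by simp
  then have "- x \<in> S"
    by (rule closed_sequentially[OF S(1) mem])
  then have "x \<in> S \<inter> uminus ` S"
    using x by (metis IntI image_eqI minus_minus)
  then show False
    using S(3) x(2) by blast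
qed

section \<open>Stellar subdivisions of fans\<close>

lemma fan_cone:
  assumes "polyhedral_fan \<Sigma>" "\<sigma> \<in> \<Sigma>"
  shows "pointed_polyhedral_cone \<sigma>" "convex_cone \<sigma>" "0 \<in> \<sigma>"
  using assms convex_cone_contains_0
  unfolding polyhedral_fan_def pointed_polyhedral_cone_def by blast+

lemma fan_face: "polyhedral_fan \<Sigma> \<Longrightarrow> \<sigma> \<in> \<Sigma> \<Longrightarrow> \<rho> face_of \<sigma> \<Longrightarrow> \<rho> \<noteq> {} \<Longrightarrow> \<rho> \<in> \<Sigma>"
  unfolding polyhedral_fan_def by blast

lemma fan_Int_face:
  assumes "polyhedral_fan \<Sigma>" "\<sigma> \<in> \<Sigma>" "\<rho> \<in> \<Sigma>"
  shows "\<sigma> \<inter> \<rho> face_of \<sigma>" "\<sigma> \<inter> \<rho> face_of \<rho>"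
  using assms unfolding polyhedral_fan_def by blast+

lemma fan_Int:
  assumes "polyhedral_fan \<Sigma>" "\<sigma> \<in> \<Sigma>" "\<rho> \<in> \<Sigma>"
  shows "\<sigma> \<inter> \<rho> \<in> \<Sigma>"
  using assms fan_face fan_Int_face fan_cone(3) by (metis IntI empty_iff)

lemma fan_subset_face:
  assumes "polyhedral_fan \<Sigma>" "\<sigma> \<in> \<Sigma>" "\<rho> \<in> \<Sigma>" "\<rho> \<subseteq> \<sigma>"
  shows "\<rho> face_of \<sigma>"
  using fan_Int_face(1)[OF assms(1-3)] assms(4) by (simp add: Int_absorb1)

text \<open>The intersection of the two cones is a face of \<sigma>; no inclusion between \<sigma>
  and \<rho> is assumed.\<close>

lemma fan_split:
  assumes fan: "polyhedral_fan \<Sigma>" and "\<sigma> \<in> \<Sigma>" "\<rho> \<in> \<Sigma>"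
    and "u \<in> \<sigma>" "v \<in> \<sigma>" "u + v \<in> \<rho>"
  shows "u \<in> \<rho>" "v \<in> \<rho>"
proof -
  have "\<sigma> \<inter> \<rho> face_of \<sigma>" "convex_cone (\<sigma> \<inter> \<rho>)"
    using fan_Int_face(1) fan_Int fan_cone(2) assms(1-3) by blast+
  moreover have "u + v \<in> \<sigma> \<inter> \<rho>"
    using assms convex_cone_add fan_cone(2) by blast
  ultimately show "u \<in> \<rho>" "v \<in> \<rho>"
    using face_of_convex_cone_iff[OF fan_cone(2)[OF fan assms(2)]] assms(4,5) by blast+
qed

lemma fan_zero_le: "polyhedral_fan \<Sigma> \<Longrightarrow> \<sigma> \<in> \<Sigma> \<Longrightarrow> {0} \<subseteq> \<sigma>"
  using fan_cone(3) by blast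

section \<open>A single stellar subdivision\<close>

locale stellar =
  fixes \<Sigma> :: "'a::euclidean_space set set" and \<tau> :: "'a set" and x :: 'a
  assumes fan: "polyhedral_fan \<Sigma>" and \<tau>: "\<tau> \<in> \<Sigma>" "\<tau> \<noteq> {0}" and x: "x \<in> rel_interior \<tau>"
begin

definition old :: "'a set set" where
  "old = \<Sigma> - fan_star \<tau> \<Sigma>"

definition link :: "'a set set" where
  "link = {\<rho> \<in> old. \<exists>\<sigma>\<in>fan_star \<tau> \<Sigma>. \<rho> \<subseteq> \<sigma>}"

definition ext :: "'a set \<Rightarrow> 'a set" where
  "ext \<rho> = convex_cone hull (insert x \<rho>)"

lemma stellar_subdivision_eq: "stellar_subdivision \<Sigma> \<tau> x = old \<union> ext ` link"
  unfolding stellar_subdivision_def old_def link_def ext_def by blast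

lemma x_in_\<tau>: "x \<in> \<tau>"
  using x rel_interior_subset by blast

text \<open>A face of \<tau> that meets its relative interior is all of \<tau>; this is applied to
  the face \<open>\<tau> \<inter> \<sigma>\<close>. The star of \<tau> can then be handled by
  testing a single point.\<close>

lemma x_mem_iff: "\<sigma> \<in> \<Sigma> \<Longrightarrow> x \<in> \<sigma> \<longleftrightarrow> \<tau> \<subseteq> \<sigma>"
  using fan_Int_face(1)[OF fan \<tau>(1)] subset_of_face_of[of "\<tau> \<inter> \<sigma>" \<tau> \<tau>] x x_in_\<tau> by blast

lemma old_iff: "\<rho> \<in> old \<longleftrightarrow> \<rho> \<in> \<Sigma> \<and> x \<notin> \<rho>"
  using x_mem_iff unfolding old_def fan_star_def by blast

lemma link_iff: "\<rho> \<in> link \<longleftrightarrow> \<rho> \<in> old \<and> (\<exists>\<sigma>\<in>\<Sigma>. x \<in> \<sigma> \<and> \<rho> \<subseteq> \<sigma>)"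
  using x_mem_iff unfolding link_def fan_star_def by blast

lemma x_nonzero: "x \<noteq> 0"
proof
  assume "x = 0"
  moreover have "{0} \<in> \<Sigma>"
    using fan by (simp add: polyhedral_fan_def)
  ultimately have "\<tau> \<subseteq> {0}"
    using x_mem_iff[of "{0}"] by simp
  then show False
    using \<tau> x_in_\<tau> by blast
qed

lemma link_old: "link \<subseteq> old"
  unfolding link_def by blast

lemma link_fan: "\<rho> \<in> link \<Longrightarrow> \<rho> \<in> \<Sigma>"
  unfolding link_def old_def by blast

text \<open>Faces of polyhedra are exposed. The functional \<open>c\<close> that exposes \<rho> in a
  star cone \<sigma> vanishes on \<rho>, because \<open>0 \<in> \<rho>\<close>, but not at
  \<open>x\<close>; rescaling gives height 1 at \<open>x\<close>.\<close>

lemma link_extension: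
  assumes "\<rho> \<in> link"
  obtains a where "cone_extension \<rho> x a"
proof -
  obtain \<sigma> where \<sigma>: "\<sigma> \<in> \<Sigma>" "x \<in> \<sigma>" "\<rho> \<subseteq> \<sigma>" and \<rho>: "\<rho> \<in> \<Sigma>" "x \<notin> \<rho>"
    using assms link_iff old_iff by blast
  have "\<rho> face_of \<sigma>"
    by (rule fan_subset_face[OF fan \<sigma>(1) \<rho>(1) \<sigma>(3)])
  moreover have "polyhedron \<sigma>"
    using fan_cone(1)[OF fan \<sigma>(1)] by (simp add: pointed_polyhedral_cone_def)
  ultimately have "\<rho> exposed_face_of \<sigma>"
    by (simp add: exposed_face_of_polyhedron)
  then obtain c b where c: "\<rho> = \<sigma> \<inter> {y. c \<bullet> y = b}"
    unfolding exposed_face_of_def by blast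
  have "b = 0"
    using c fan_cone(3)[OF fan \<rho>(1)] by auto
  moreover have "c \<bullet> x \<noteq> b"
    using c \<sigma> \<rho> by blast
  ultimately have "cone_extension \<rho> x ((1 / (c \<bullet> x)) *\<^sub>R c)"
    using fan_cone(1)[OF fan \<rho>(1)] c by unfold_locales auto
  then show ?thesis
    using that by blast
qed

lemma mem_ext: "\<rho> \<in> \<Sigma> \<Longrightarrow> y \<in> ext \<rho> \<longleftrightarrow> (\<exists>t\<ge>0. \<exists>r\<in>\<rho>. y = t *\<^sub>R x + r)"
  unfolding ext_def by (rule mem_convex_cone_hull_insert[OF fan_cone(2)[OF fan]])

lemma in_ext: "x \<in> ext \<rho>" "\<rho> \<subseteq> ext \<rho>"
  unfolding ext_def by (auto intro: hull_inc)

text \<open>Both \<open>t *\<^sub>R x\<close> and \<open>r\<close> lie in a star cone above \<rho>.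
  For positive \<open>t\<close>, \<open>fan_split\<close> would pull \<open>t *\<^sub>R x\<close>,
  hence \<open>x\<close>, into the old cone \<open>\<rho>'\<close>.\<close>

lemma height_zero:
  assumes "\<rho> \<in> link" "\<rho>' \<in> old" "r \<in> \<rho>" "0 \<le> t" "t *\<^sub>R x + r \<in> \<rho>'"
  shows "t = 0"
proof (rule ccontr)
  assume "t \<noteq> 0"
  obtain \<sigma> where \<sigma>: "\<sigma> \<in> \<Sigma>" "x \<in> \<sigma>" "\<rho> \<subseteq> \<sigma>"
    using assms(1) link_iff by blast
  have \<rho>': "\<rho>' \<in> \<Sigma>" "x \<notin> \<rho>'"
    using assms(2) old_iff by auto
  have "t *\<^sub>R x \<in> \<sigma>" "r \<in> \<sigma>"
    using convex_cone_scaleR[OF fan_cone(2)[OF fan \<sigma>(1)]] assms \<sigma> by auto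
  then have "t *\<^sub>R x \<in> \<rho>'"
    using fan_split(1)[OF fan \<sigma>(1) \<rho>'(1)] assms(5) by blast
  then have "(1 / t) *\<^sub>R t *\<^sub>R x \<in> \<rho>'"
    by (rule convex_cone_scaleR[OF fan_cone(2)[OF fan \<rho>'(1)], rotated]) (use assms(4) in simp)
  then show False
    using \<rho>'(2) \<open>t \<noteq> 0\<close> by simp
qed

text \<open>The two link cones may lie in different star cones, so one functional need not serve
  both. Instead the smaller multiple of \<open>x\<close> is subtracted on both sides and
  \<open>height_zero\<close> is applied to the difference.\<close>

lemma height_unique:
  assumes link: "\<rho> \<in> link" "\<rho>' \<in> link" and "r \<in> \<rho>" "r' \<in> \<rho>'" "0 \<le> t" "0 \<le> t'"
    and eq: "t *\<^sub>R x + r = t' *\<^sub>R x + r'"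
  shows "t = t'" "r = r'"
proof -
  have "(t' - t) *\<^sub>R x + r' = r" "(t - t') *\<^sub>R x + r = r'"
    using eq by (simp_all add: algebra_simps)
  then show "t = t'"
    using height_zero[OF link(2) _ \<open>r' \<in> \<rho>'\<close>, of \<rho> "t' - t"]
      height_zero[OF link(1) _ \<open>r \<in> \<rho>\<close>, of \<rho>' "t - t'"] assms link_old
    by (cases "t \<le> t'") auto
  with eq show "r = r'"
    by simp
qed

lemma link_down: "\<rho> \<in> link \<Longrightarrow> \<rho>' \<in> \<Sigma> \<Longrightarrow> \<rho>' \<subseteq> \<rho> \<Longrightarrow> \<rho>' \<in> link"
  unfolding link_iff old_iff by blast

lemma ext_Int_old:
  assumes "\<rho> \<in> link" "\<rho>' \<in> old"
  shows "ext \<rho> \<inter> \<rho>' = \<rho> \<inter> \<rho>'"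
proof -
  have "y \<in> \<rho>" if y: "y \<in> ext \<rho>" "y \<in> \<rho>'" for y
  proof -
    obtain t r where "0 \<le> t" "r \<in> \<rho>" "y = t *\<^sub>R x + r"
      using y(1) mem_ext[OF link_fan[OF assms(1)]] by auto
    with height_zero[OF assms, of r t] y show ?thesis
      by simp
  qed
  then show ?thesis
    using in_ext by blast
qed

lemma ext_Int_ext:
  assumes "\<rho> \<in> link" "\<rho>' \<in> link"
  shows "ext \<rho> \<inter> ext \<rho>' = ext (\<rho> \<inter> \<rho>')"
proof
  have mem: "\<rho> \<in> \<Sigma>" "\<rho>' \<in> \<Sigma>"
    using assms link_iff old_iff by auto
  have Int: "\<rho> \<inter> \<rho>' \<in> \<Sigma>"
    using fan_Int[OF fan mem] .
  show "ext \<rho> \<inter> ext \<rho>' \<subseteq> ext (\<rho> \<inter> \<rho>')"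
  proof
    fix y assume "y \<in> ext \<rho> \<inter> ext \<rho>'"
    then obtain t r t' r' where "0 \<le> t" "r \<in> \<rho>" "y = t *\<^sub>R x + r"
        "0 \<le> t'" "r' \<in> \<rho>'" "y = t' *\<^sub>R x + r'"
      using mem_ext mem by (metis IntD1 IntD2)
    then show "y \<in> ext (\<rho> \<inter> \<rho>')"
      using height_unique[OF assms, of r r' t t'] mem_ext[OF Int] by auto
  qed
  show "ext (\<rho> \<inter> \<rho>') \<subseteq> ext \<rho> \<inter> ext \<rho>'"
    unfolding ext_def by (auto intro: hull_mono[THEN subsetD, rotated])
qed

text \<open>This and the next two lemmas reduce every inclusion between cones of the subdivision to
  one in \<Sigma>, from which the face poset after the step is read off.\<close>

lemma old_subset_ext_iff: "\<rho> \<in> link \<Longrightarrow> \<rho>' \<in> old \<Longrightarrow> \<rho>' \<subseteq> ext \<rho> \<longleftrightarrow> \<rho>' \<subseteq> \<rho>"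
  using ext_Int_old in_ext(2) by blast

lemma ext_not_subset_old: "\<rho>' \<in> old \<Longrightarrow> \<not> ext \<rho> \<subseteq> \<rho>'"
  using in_ext(1) old_iff by blast

lemma ext_subset_ext_iff:
  assumes "\<rho> \<in> link" "\<rho>' \<in> link"
  shows "ext \<rho> \<subseteq> ext \<rho>' \<longleftrightarrow> \<rho> \<subseteq> \<rho>'"
proof
  assume "ext \<rho> \<subseteq> ext \<rho>'"
  then have "\<rho> \<subseteq> ext \<rho>'"
    using in_ext(2) by blast
  then show "\<rho> \<subseteq> \<rho>'"
    using old_subset_ext_iff assms link_old by blast
qed (auto simp: ext_def intro: hull_mono[THEN subsetD, rotated])

lemma fan_faces_Int:
  assumes "\<rho> \<in> link" "\<rho>' \<in> \<Sigma>"
  shows "\<rho> \<inter> \<rho>' \<in> link" "\<rho> \<inter> \<rho>' face_of \<rho>" "\<rho> \<inter> \<rho>' \<noteq> {}"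
proof -
  have \<rho>: "\<rho> \<in> \<Sigma>"
    using assms(1) by (rule link_fan)
  show "\<rho> \<inter> \<rho>' \<in> link"
    by (rule link_down[OF assms(1) fan_Int[OF fan \<rho> assms(2)]]) simp
  show "\<rho> \<inter> \<rho>' face_of \<rho>"
    by (rule fan_Int_face(1)[OF fan \<rho> assms(2)])
  show "\<rho> \<inter> \<rho>' \<noteq> {}"
    using fan_cone(3)[OF fan fan_Int[OF fan \<rho> assms(2)]] by blast
qed

text \<open>Faces of an extended cone are link cones or extensions of link cones, and intersections
  involving extended cones reduce to intersections in \<Sigma> by \<open>ext_Int_old\<close> and
  \<open>ext_Int_ext\<close>.\<close>

lemma polyhedral_fan_stellar: "polyhedral_fan (stellar_subdivision \<Sigma> \<tau> x)"
  unfolding polyhedral_fan_def stellar_subdivision_eq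
proof (intro conjI ballI allI impI; (elim conjE)?)
  have "finite old"
    using fan unfolding polyhedral_fan_def old_def by blast
  then show "finite (old \<union> ext ` link)"
    using link_old finite_subset by blast
  have "{0} \<in> old"
    using x_nonzero fan old_iff unfolding polyhedral_fan_def by blast
  then show "{0} \<in> old \<union> ext ` link" ..
next
  fix \<sigma> assume "\<sigma> \<in> old \<union> ext ` link"
  then consider "\<sigma> \<in> old" | \<rho> where "\<rho> \<in> link" "\<sigma> = ext \<rho>"
    by blast
  then show "pointed_polyhedral_cone \<sigma>"
  proof cases
    case 1
    then show ?thesis
      using fan_cone(1)[OF fan] old_iff by blast
  next
    case 2
    then show ?thesis
      using link_extension cone_extension.pointed_polyhedral_cone_extension ext_def by metis
  qed
next
  fix \<sigma> F :: "'a set" assume F: "F face_of \<sigma>" "F \<noteq> {}"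
  assume "\<sigma> \<in> old \<union> ext ` link"
  then consider "\<sigma> \<in> old" | \<rho> where "\<rho> \<in> link" "\<sigma> = ext \<rho>"
    by blast
  then show "F \<in> old \<union> ext ` link"
  proof cases
    case 1
    then show ?thesis
      using F fan_face[OF fan] face_of_imp_subset old_iff by blast
  next
    case 2
    have \<rho>: "\<rho> \<in> \<Sigma>"
      using 2 link_iff old_iff by blast
    have faces: "F' \<in> link" if "F' face_of \<rho>" "F' \<noteq> {}" for F'
      using that 2 \<rho> fan_face[OF fan] link_down face_of_imp_subset by blast
    obtain a where "cone_extension \<rho> x a"
      using link_extension 2 by blast
    then have "F face_of \<rho> \<or> (\<exists>F'. F' face_of \<rho> \<and> F' \<noteq> {} \<and> F = ext F')"
      using cone_extension.face_of_extension F 2 unfolding ext_def by blast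
    then show ?thesis
      using faces F(2) link_old by blast
  qed
next
  have base: "\<rho> face_of ext \<rho>" if "\<rho> \<in> link" for \<rho>
    using that link_extension cone_extension.base_face ext_def by metis
  have ext: "ext F face_of ext \<rho>" if "\<rho> \<in> link" "F face_of \<rho>" "F \<noteq> {}" for \<rho> F
    using that link_extension cone_extension.extension_face ext_def by metis
  have ext_old: "ext \<rho> \<inter> \<rho>' face_of ext \<rho> \<and> ext \<rho> \<inter> \<rho>' face_of \<rho>'" if "\<rho> \<in> link" "\<rho>' \<in> old" for \<rho> \<rho>'
    using that ext_Int_old base face_of_trans fan_Int_face[OF fan] link_iff old_iff
    by metis
  fix \<sigma> \<sigma>' assume "\<sigma> \<in> old \<union> ext ` link" "\<sigma>' \<in> old \<union> ext ` link"
  then consider "\<sigma> \<in> old" "\<sigma>' \<in> old" | \<rho> where "\<rho> \<in> link" "\<sigma> = ext \<rho>" "\<sigma>' \<in> old"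
    | \<rho> where "\<sigma> \<in> old" "\<rho> \<in> link" "\<sigma>' = ext \<rho>"
    | \<rho> \<rho>' where "\<rho> \<in> link" "\<sigma> = ext \<rho>" "\<rho>' \<in> link" "\<sigma>' = ext \<rho>'"
    by blast
  then have "\<sigma> \<inter> \<sigma>' face_of \<sigma> \<and> \<sigma> \<inter> \<sigma>' face_of \<sigma>'"
  proof cases
    case 1
    then show ?thesis
      using fan_Int_face[OF fan] old_iff by blast
  next
    case 2
    then show ?thesis
      using ext_old by blast
  next
    case 3
    then show ?thesis
      using ext_old Int_commute by metis
  next
    case 4
    have "\<rho> \<in> \<Sigma>" "\<rho>' \<in> \<Sigma>"
      using 4 link_iff old_iff by auto
    then show ?thesis
      using ext 4 ext_Int_ext fan_faces_Int by (metis Int_commute)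
  qed
  then show "\<sigma> \<inter> \<sigma>' face_of \<sigma>" "\<sigma> \<inter> \<sigma>' face_of \<sigma>'"
    by auto
qed

text \<open>Subtract from \<open>p\<close> the largest multiple of \<open>x\<close> that keeps it in the cone; the result lies
  in a face that avoids \<open>x\<close>.\<close>

lemma star_covered:
  assumes \<sigma>: "\<sigma> \<in> \<Sigma>" "x \<in> \<sigma>" and p: "p \<in> \<sigma>"
  shows "\<exists>\<rho>\<in>link. p \<in> ext \<rho>"
proof -
  define T where "T = {t. 0 \<le> t \<and> p - t *\<^sub>R x \<in> \<sigma>}"
  have cone: "convex_cone \<sigma>" "\<sigma> \<inter> uminus ` \<sigma> = {0}" "closed \<sigma>"
    using fan_cone(1)[OF fan \<sigma>(1)] polyhedron_imp_closed
    unfolding pointed_polyhedral_cone_def by blast+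
  have "bounded T"
    unfolding T_def by (rule convex_cone_bounded_translates[OF cone(3,1,2) \<sigma>(2) x_nonzero])
  moreover have "closed T"
  proof -
    have "T = {0..} \<inter> (\<lambda>t. p - t *\<^sub>R x) -` \<sigma>"
      unfolding T_def by auto
    moreover have "closed ((\<lambda>t. p - t *\<^sub>R x) -` \<sigma>)"
      by (intro closed_vimage cone continuous_intros)
    ultimately show ?thesis
      by (simp add: closed_Int)
  qed
  ultimately have "compact T"
    by (simp add: compact_eq_bounded_closed)
  moreover have "0 \<in> T"
    using p T_def by simp
  ultimately obtain t where t: "t \<in> T" "\<And>s. s \<in> T \<Longrightarrow> s \<le> t"
    using compact_attains_sup[of T] by blast
  define q where "q = p - t *\<^sub>R x"
  have q: "q \<in> \<sigma>" "0 \<le> t"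
    using t(1) T_def q_def by auto
  \<comment> \<open>The smallest face of \<sigma> containing \<open>q\<close>. By minimality
    \<open>q\<close> lies on no proper face of \<open>F\<close>, hence in its relative
    interior.\<close>
  define F where "F = \<Inter>{G. G face_of \<sigma> \<and> q \<in> G}"
  have "\<sigma> face_of \<sigma>"
    using cone(1) by (simp add: convex_cone_def face_of_refl)
  then have "F face_of \<sigma>"
    unfolding F_def using q(1) by (intro face_of_Inter) auto
  moreover have qF: "q \<in> F"
    unfolding F_def by blast
  ultimately have F: "F \<in> \<Sigma>" "F \<subseteq> \<sigma>" "F face_of \<sigma>"
    using fan_face[OF fan \<sigma>(1)] face_of_imp_subset by blast+
  have "q \<in> rel_interior F"
  proof (rule ccontr)
    assume "q \<notin> rel_interior F"
    then have "q \<in> rel_frontier F"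
      using qF by (simp add: rel_frontier_def closure_subset[THEN subsetD])
    moreover have "polyhedron F"
      using fan_cone(1)[OF fan F(1)] pointed_polyhedral_cone_def by blast
    ultimately obtain H where "H face_of F" "H \<noteq> F" "q \<in> H"
      by (auto simp: rel_frontier_of_polyhedron_alt)
    moreover from this have "H face_of \<sigma>"
      using F(3) face_of_trans by blast
    then have "F \<subseteq> H"
      using \<open>q \<in> H\<close> unfolding F_def by blast
    ultimately show False
      using face_of_imp_subset by blast
  qed
  have "x \<notin> F"
  proof
    assume "x \<in> F"
    obtain e where e: "e > 0" "cball q e \<inter> affine hull F \<subseteq> F"
      using \<open>q \<in> rel_interior F\<close> by (auto simp: rel_interior_cball)
    define d where "d = e / norm x"
    have d: "d > 0"
      using e x_nonzero d_def by simp
    have "0 \<in> F"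
      using fan_cone(3)[OF fan F(1)] .
    then have "affine hull F = span F"
      by (simp add: affine_hull_span_0 hull_inc)
    then have "q - d *\<^sub>R x \<in> affine hull F"
      using qF \<open>x \<in> F\<close> by (simp add: span_base span_diff span_scale)
    moreover have "q - d *\<^sub>R x \<in> cball q e"
      using e x_nonzero by (simp add: dist_norm d_def)
    ultimately have "q - d *\<^sub>R x \<in> \<sigma>"
      using e F by blast
    then have "t + d \<in> T"
      unfolding T_def q_def using q d by (simp add: algebra_simps)
    then show False
      using t(2) d by fastforce
  qed
  then have "F \<in> link"
    using F \<sigma> link_iff old_iff by blast
  moreover have "p \<in> ext F"
    unfolding mem_ext[OF F(1)] q_def using q qF by (auto simp: q_def intro!: exI[of _ t] bexI[of _ q])
  ultimately show ?thesis
    by blast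
qed

lemma fan_subdivision_stellar: "fan_subdivision (stellar_subdivision \<Sigma> \<tau> x) \<Sigma>"
proof -
  have sub: "\<exists>\<sigma>\<in>\<Sigma>. \<sigma>' \<subseteq> \<sigma>" if mem: "\<sigma>' \<in> old \<union> ext ` link" for \<sigma>'
  proof (cases "\<sigma>' \<in> old")
    case False
    then obtain \<rho> where \<rho>: "\<sigma>' = ext \<rho>" "\<rho> \<in> link"
      using mem by blast
    then obtain \<sigma> where "\<sigma> \<in> \<Sigma>" "x \<in> \<sigma>" "\<rho> \<subseteq> \<sigma>"
      using link_iff by blast
    moreover then have "ext \<rho> \<subseteq> \<sigma>"
      unfolding ext_def using fan_cone(2)[OF fan] by (intro hull_minimal) auto
    ultimately show ?thesis
      using \<rho> by blast
  qed (use old_iff in blast)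
  have "p \<in> \<Union>(old \<union> ext ` link)" if "\<sigma> \<in> \<Sigma>" "p \<in> \<sigma>" for p \<sigma>
  proof (cases "x \<in> \<sigma>")
    case True
    then show ?thesis
      using star_covered that by blast
  next
    case False
    then show ?thesis
      using old_iff that by blast
  qed
  then have "\<Union>(old \<union> ext ` link) = \<Union>\<Sigma>"
    using sub by blast
  then show ?thesis
    unfolding fan_subdivision_def
    using sub fan polyhedral_fan_stellar stellar_subdivision_eq by simp
qed

end

section \<open>Combinatorial blow-ups, building sets and nested sets\<close>

text \<open>The elements of the combinatorial blow-up of \<open>L\<close> along the list \<open>Gs\<close>: the pair \<open>(N, s)\<close>
  stands for the element \<open>s\<close> extended by the new atoms belonging to \<open>N\<close>. In a meet-semilattice, the
  existence of \<open>u\<close> says that the join of \<open>s\<close> and of the members of \<open>N\<close> that come after \<open>Gs ! l\<close>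
  in the list is not above \<open>Gs ! l\<close>.\<close>

definition blowup_pairs :: "'p::order set \<Rightarrow> 'p list \<Rightarrow> ('p set \<times> 'p) set" where
  "blowup_pairs L Gs = {(N, s). N \<subseteq> set Gs \<and> s \<in> L \<and> (\<exists>u\<in>L. s \<le> u \<and> (\<forall>g\<in>N. g \<le> u)) \<and>
     (\<forall>l<length Gs. \<exists>u\<in>L. s \<le> u \<and> \<not> Gs ! l \<le> u \<and>
        (\<forall>m. l < m \<longrightarrow> m < length Gs \<longrightarrow> Gs ! m \<in> N \<longrightarrow> Gs ! m \<le> u))}"

lemma blowup_pairs_Nil: "blowup_pairs L [] = (\<lambda>s. ({}, s)) ` L"
  unfolding blowup_pairs_def by auto

lemma blowup_pairs_down:
  assumes "(N, s) \<in> blowup_pairs L Gs" "N' \<subseteq> N" "s' \<le> s" "s' \<in> L"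
  shows "(N', s') \<in> blowup_pairs L Gs"
  using assms unfolding blowup_pairs_def by (auto; meson order_trans subset_iff)

lemma finite_inf_closed_join:
  fixes L :: "'p::semilattice_inf set"
  assumes L: "finite L" "\<And>a b. a \<in> L \<Longrightarrow> b \<in> L \<Longrightarrow> inf a b \<in> L"
    and ub: "u \<in> L" "\<forall>a\<in>A. a \<le> u"
  shows "\<exists>j. is_join L A j"
proof -
  define U where "U = {u \<in> L. \<forall>a\<in>A. a \<le> u}"
  have "finite U" "U \<noteq> {}"
    using L ub U_def by auto
  then obtain j where j: "j \<in> U" "\<And>u. u \<in> U \<Longrightarrow> \<not> u < j"
    using finite_has_minimal by (metis less_le)
  have "j \<le> u" if "u \<in> U" for u
  proof -
    have "inf j u \<in> U"
      using that j(1) L(2) U_def by auto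
    then have "inf j u = j"
      using j(2) by (metis inf_le1 less_le)
    then show ?thesis
      by (simp add: le_iff_inf)
  qed
  with j(1) show ?thesis
    unfolding is_join_def U_def by blast
qed

text \<open>The combinatorial counterpart of one stellar subdivision: the first set collects the
  pairs outside the star of \<open>g\<close>, the second the extensions of the link. A link pair
  lies below a star pair, which can be taken with the same \<open>N\<close>.\<close>

lemma blowup_pairs_snoc:
  fixes L :: "'p::semilattice_inf set"
  assumes L: "finite L" "\<And>a b. a \<in> L \<Longrightarrow> b \<in> L \<Longrightarrow> inf a b \<in> L"
    and g: "g \<in> L" "g \<notin> set Gs"
  shows "blowup_pairs L (Gs @ [g]) =
     {p \<in> blowup_pairs L Gs. \<not> g \<le> snd p} \<union>
     {(insert g N, s) |N s. (N, s) \<in> blowup_pairs L Gs \<and> \<not> g \<le> s \<and>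
        (\<exists>s'. (N, s') \<in> blowup_pairs L Gs \<and> s \<le> s' \<and> g \<le> s')}"
    (is "?lhs = ?old \<union> ?new")
proof (intro set_eqI iffI)
  have last: "(\<forall>m. l < m \<longrightarrow> m < Suc (length Gs) \<longrightarrow> (Gs @ [g]) ! m \<in> N \<longrightarrow> (Gs @ [g]) ! m \<le> u) \<longleftrightarrow>
      (\<forall>m. l < m \<longrightarrow> m < length Gs \<longrightarrow> Gs ! m \<in> N \<longrightarrow> Gs ! m \<le> u) \<and> (g \<in> N \<longrightarrow> g \<le> u)"
    if "l < length Gs" for l u N
    using that by (auto simp: nth_append less_Suc_eq)
  have mem: "(N, s) \<in> ?lhs \<longleftrightarrow> N \<subseteq> insert g (set Gs) \<and> s \<in> L \<and> \<not> g \<le> s \<and>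
      (\<exists>u\<in>L. s \<le> u \<and> (\<forall>g\<in>N. g \<le> u)) \<and>
      (\<forall>l<length Gs. \<exists>u\<in>L. s \<le> u \<and> \<not> Gs ! l \<le> u \<and>
        (\<forall>m. l < m \<longrightarrow> m < length Gs \<longrightarrow> Gs ! m \<in> N \<longrightarrow> Gs ! m \<le> u) \<and> (g \<in> N \<longrightarrow> g \<le> u))" for N s
  proof -
    define P where "P l u \<longleftrightarrow> s \<le> u \<and> \<not> (Gs @ [g]) ! l \<le> u \<and>
        (\<forall>m. l < m \<longrightarrow> m < Suc (length Gs) \<longrightarrow> (Gs @ [g]) ! m \<in> N \<longrightarrow> (Gs @ [g]) ! m \<le> u)" for l u
    have "(N, s) \<in> ?lhs \<longleftrightarrow> N \<subseteq> insert g (set Gs) \<and> s \<in> L \<and>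
        (\<exists>u\<in>L. s \<le> u \<and> (\<forall>g\<in>N. g \<le> u)) \<and> (\<forall>l<Suc (length Gs). \<exists>u\<in>L. P l u)"
      unfolding blowup_pairs_def P_def by simp
    moreover have "(\<forall>l<Suc (length Gs). \<exists>u\<in>L. P l u) \<longleftrightarrow>
        (\<exists>u\<in>L. P (length Gs) u) \<and> (\<forall>l<length Gs. \<exists>u\<in>L. P l u)"
      by (auto simp: less_Suc_eq)
    \<comment> \<open>No entry follows \<open>g\<close>, so the condition at the last index is best
      met by \<open>u = s\<close>.\<close>
    moreover have "(\<exists>u\<in>L. P (length Gs) u) \<longleftrightarrow> \<not> g \<le> s" if "s \<in> L"
      unfolding P_def using that by (auto intro: order_trans)
    moreover have "P l u \<longleftrightarrow> s \<le> u \<and> \<not> Gs ! l \<le> u \<and>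
        (\<forall>m. l < m \<longrightarrow> m < length Gs \<longrightarrow> Gs ! m \<in> N \<longrightarrow> Gs ! m \<le> u) \<and> (g \<in> N \<longrightarrow> g \<le> u)"
      if "l < length Gs" for l u
      unfolding P_def last[OF that] using that by (simp add: nth_append)
    ultimately show ?thesis
      by (simp cong: conj_cong) blast
  qed
  fix p :: "'p set \<times> 'p"
  obtain N s where p: "p = (N, s)"
    by fastforce
  {
    assume "p \<in> ?lhs"
    then have "(N, s) \<in> ?lhs"
      using p by simp
    note N = this[unfolded mem]
    show "p \<in> ?old \<union> ?new"
    proof (cases "g \<in> N")
      case False
      then have "p \<in> ?old"
        using N unfolding p blowup_pairs_def by auto
      then show ?thesis ..
    next
      case True
      define M where "M = N - {g}"
      have M: "N = insert g M" "M \<subseteq> set Gs"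
        using True N M_def by auto
      \<comment> \<open>Since \<open>g \<in> N\<close>, the bound \<open>u\<close> makes the join
        \<open>s'\<close> of \<open>s\<close> and \<open>g\<close> exist. The bounds that witness
        the conditions for \<open>(N, s)\<close> at the earlier indices are above both, hence above
        \<open>s'\<close>, and witness those for \<open>(M, s')\<close>.\<close>
      obtain u where u: "u \<in> L" "s \<le> u" "\<forall>h\<in>N. h \<le> u"
        using N by blast
      then obtain s' where s': "is_join L {s, g} s'"
        using finite_inf_closed_join[OF L, of u "{s, g}"] True by auto
      have le_s': "s' \<le> v" if "v \<in> L" "s \<le> v" "g \<le> v" for v
        using s' that unfolding is_join_def by simp
      have "(M, s') \<in> blowup_pairs L Gs"
        unfolding blowup_pairs_def
      proof (intro CollectI case_prodI conjI allI impI)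
        show "M \<subseteq> set Gs" "s' \<in> L"
          using M s' is_join_def by auto
        show "\<exists>u\<in>L. s' \<le> u \<and> (\<forall>g\<in>M. g \<le> u)"
          using u le_s'[of u] True M(1) by blast
        fix l assume "l < length Gs"
        then obtain v where "v \<in> L" "s \<le> v" "\<not> Gs ! l \<le> v" "g \<le> v"
            "\<forall>m. l < m \<longrightarrow> m < length Gs \<longrightarrow> Gs ! m \<in> N \<longrightarrow> Gs ! m \<le> v"
          using N True by blast
        then show "\<exists>u\<in>L. s' \<le> u \<and> \<not> Gs ! l \<le> u \<and>
            (\<forall>m. l < m \<longrightarrow> m < length Gs \<longrightarrow> Gs ! m \<in> M \<longrightarrow> Gs ! m \<le> u)"
          using le_s' M(1) by blast
      qed
      moreover have "s \<le> s'" "g \<le> s'"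
        using s' unfolding is_join_def by auto
      moreover have "(M, s) \<in> blowup_pairs L Gs"
        using blowup_pairs_down calculation N by blast
      ultimately have "p \<in> ?new"
        using p M(1) N by blast
      then show ?thesis ..
    qed
  next
    assume "p \<in> ?old \<union> ?new"
    then show "p \<in> ?lhs"
    proof
      assume "p \<in> ?old"
      then have "(N, s) \<in> blowup_pairs L Gs" "\<not> g \<le> s"
        using p by auto
      moreover then have "g \<notin> N"
        using g(2) unfolding blowup_pairs_def by blast
      ultimately show "p \<in> ?lhs"
        unfolding p mem by (auto simp: blowup_pairs_def)
    next
      assume "p \<in> ?new"
      then obtain M s' where M: "N = insert g M" "(M, s) \<in> blowup_pairs L Gs" "\<not> g \<le> s"
          "(M, s') \<in> blowup_pairs L Gs" "s \<le> s'" "g \<le> s'"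
        using p by blast
      show "p \<in> ?lhs"
        unfolding p mem
      proof (intro conjI allI impI)
        show "N \<subseteq> insert g (set Gs)" "s \<in> L" "\<not> g \<le> s"
          using M unfolding blowup_pairs_def by auto
        obtain u where "u \<in> L" "s' \<le> u" "\<forall>g\<in>M. g \<le> u"
          using M(4) unfolding blowup_pairs_def by blast
        then show "\<exists>u\<in>L. s \<le> u \<and> (\<forall>g\<in>N. g \<le> u)"
          using M order_trans by blast
        fix l assume l: "l < length Gs"
        then obtain u where u: "u \<in> L" "s' \<le> u" "\<not> Gs ! l \<le> u"
            "\<forall>m. l < m \<longrightarrow> m < length Gs \<longrightarrow> Gs ! m \<in> M \<longrightarrow> Gs ! m \<le> u"
          using M(4) unfolding blowup_pairs_def by blast
        have "Gs ! m \<le> u" if "l < m" "m < length Gs" "Gs ! m \<in> N" for m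
        proof -
          have "Gs ! m \<noteq> g"
            using g(2) nth_mem[OF that(2)] by metis
          then show ?thesis
            using u(4) that M(1) by simp
        qed
        then show "\<exists>u\<in>L. s \<le> u \<and> \<not> Gs ! l \<le> u \<and>
            (\<forall>m. l < m \<longrightarrow> m < length Gs \<longrightarrow> Gs ! m \<in> N \<longrightarrow> Gs ! m \<le> u) \<and> (g \<in> N \<longrightarrow> g \<le> u)"
          using u(1,3) order_trans[OF M(5) u(2)] order_trans[OF M(6) u(2)] by blast
      qed
    qed
  }
qed

section \<open>Joins of nested sets\<close>

lemma maximal_above:
  assumes "finite S" "s \<in> S"
  shows "\<exists>m\<in>maximal_elements S. s \<le> m"
proof -
  obtain m where "m \<in> S" "s \<le> m" "\<forall>b\<in>S. m \<le> b \<longrightarrow> m = b"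
    using finite_has_maximal2[OF assms] by blast
  then show ?thesis
    unfolding maximal_elements_def by (auto simp: less_le)
qed

lemma bottom_eqI:
  assumes "z \<in> L" "\<And>x. x \<in> L \<Longrightarrow> z \<le> x"
  shows "bottom L = z"
  unfolding bottom_def by (rule Least_equality) (use assms in auto)

lemma is_join_unique: "is_join L A j \<Longrightarrow> is_join L A k \<Longrightarrow> j = k"
  unfolding is_join_def by (simp add: order_antisym)

text \<open>Nestedness speaks of antichains only; passing to maximal elements makes it applicable to
  arbitrary finite subsets.\<close>

lemma is_join_maximal_elements:
  assumes "finite A"
  shows "is_join L (maximal_elements A) j \<longleftrightarrow> is_join L A j"
proof -
  have "(\<forall>a\<in>maximal_elements A. a \<le> u) \<longleftrightarrow> (\<forall>a\<in>A. a \<le> u)" for u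
  proof
    show "\<forall>a\<in>maximal_elements A. a \<le> u \<Longrightarrow> \<forall>a\<in>A. a \<le> u"
      using maximal_above[OF assms] order_trans by blast
  qed (simp add: maximal_elements_def)
  then show ?thesis
    unfolding is_join_def by simp
qed

lemma pairwise_maximal_elements: "pairwise (\<lambda>x y. \<not> x \<le> y) (maximal_elements A)"
  unfolding pairwise_def maximal_elements_def by (auto simp: less_le)

text \<open>The maximal elements of \<open>A\<close> form an antichain with the same join. Two or
  more of them would force \<open>j \<notin> \<G>\<close>, so there is exactly one, and it equals
  \<open>j\<close>.\<close>

lemma nested_set_join_mem:
  assumes "\<G> \<subseteq> L" and N: "nested_set L \<G> N" and A: "A \<subseteq> N" "finite A" "A \<noteq> {}"
    and j: "is_join L A j" "j \<in> \<G>"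
  shows "j \<in> A"
proof -
  define M where "M = maximal_elements A"
  have MA: "M \<subseteq> A"
    unfolding M_def maximal_elements_def by blast
  then have fM: "finite M"
    using A finite_subset by blast
  have jM: "is_join L M j"
    unfolding M_def using is_join_maximal_elements A j by blast
  have "M \<noteq> {}"
    using maximal_above[OF A(2)] A(3) M_def by blast
  have "\<not> card M \<ge> 2"
  proof
    assume "card M \<ge> 2"
    then obtain k where "is_join L M k" "k \<notin> \<G>"
      using N MA A fM pairwise_maximal_elements[of A] unfolding nested_set_def M_def
      by (meson order_trans)
    then show False
      using is_join_unique[OF jM] j by blast
  qed
  moreover have "card M > 0"
    using \<open>M \<noteq> {}\<close> fM by (simp add: card_gt_0_iff)
  ultimately have "card M = 1"
    by linarith
  then obtain m where m: "M = {m}"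
    using card_1_singletonE by blast
  moreover have "m \<in> L"
    using m MA A(1) N assms(1) unfolding nested_set_def by blast
  ultimately have "j = m"
    using jM unfolding is_join_def by (auto intro: order_antisym)
  then show ?thesis
    using m MA by blast
qed

lemma nested_set_subset: "nested_set L \<G> N \<Longrightarrow> M \<subseteq> N \<Longrightarrow> nested_set L \<G> M"
  unfolding nested_set_def by (meson order_trans)

text \<open>Nestedness supplies joins of antichains with at least two elements. A single maximal
  element is its own join, and the empty set has join \<open>z\<close>.\<close>

lemma nested_set_join_ex:
  assumes "\<G> \<subseteq> L" "finite L" and z: "z \<in> L" "\<And>x. x \<in> L \<Longrightarrow> z \<le> x" and N: "nested_set L \<G> N"
  shows "\<exists>j. is_join L N j"
proof -
  define M where "M = maximal_elements N"
  have NL: "N \<subseteq> L"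
    using N assms(1) unfolding nested_set_def by blast
  have MN: "M \<subseteq> N"
    unfolding M_def maximal_elements_def by blast
  have fin: "finite N" "finite M"
    using finite_subset[OF NL assms(2)] finite_subset[OF MN] by auto
  have "\<exists>j. is_join L M j"
  proof (cases "card M \<ge> 2")
    case True
    then show ?thesis
      using N MN fin pairwise_maximal_elements[of N] unfolding nested_set_def M_def by blast
  next
    case False
    then consider "M = {}" | m where "M = {m}"
      using fin(2) by (metis One_nat_def card_1_singletonE card_0_eq less_2_cases not_less)
    then show ?thesis
    proof cases
      case 1
      then show ?thesis
        using z unfolding is_join_def by auto
    next
      case 2
      then have "is_join L M m"
        using MN NL unfolding is_join_def by auto
      then show ?thesis ..
    qed
  qed
  then show ?thesis
    unfolding M_def using is_join_maximal_elements fin(1) by blast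
qed

section \<open>Building sets and their nested sets\<close>

context
  fixes L \<G> :: "'p::semilattice_inf set" and z :: 'p
  assumes finite_L: "finite L" and inf_closed: "\<And>a b. a \<in> L \<Longrightarrow> b \<in> L \<Longrightarrow> inf a b \<in> L"
    and z: "z \<in> L" "\<And>x. x \<in> L \<Longrightarrow> z \<le> x"
    and building: "building_set L \<G>"
begin

lemma bottom_L: "bottom L = z"
  by (rule bottom_eqI) (use z in auto)

lemma building_set_subset: "\<G> \<subseteq> L" "z \<notin> \<G>"
  using building bottom_L unfolding building_set_def by blast+

lemma building_set_iso:
  assumes "x \<in> L" "x \<noteq> z" "X = maximal_elements {g \<in> \<G>. g \<le> x}"
  obtains \<phi> where "poset_iso \<phi> (\<Pi>\<^sub>E y\<in>X. lower_interval L y) (lower_interval L x)"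
    "\<And>y. y \<in> X \<Longrightarrow> \<phi> (\<lambda>w\<in>X. if w = y then y else z) = y"
  using assms building unfolding building_set_def bottom_L Let_def by blast

text \<open>Otherwise the product has no factors and consists of one point, whereas the interval
  below \<open>x\<close> contains both \<open>z\<close> and \<open>x\<close>.\<close>

lemma building_set_below:
  assumes "x \<in> L" "x \<noteq> z"
  shows "\<exists>g\<in>\<G>. g \<le> x"
proof (rule ccontr)
  assume "\<not> ?thesis"
  then have X: "{} = maximal_elements {g \<in> \<G>. g \<le> x}"
    unfolding maximal_elements_def by blast
  obtain \<phi> where "poset_iso \<phi> (\<Pi>\<^sub>E y\<in>{}. lower_interval L y) (lower_interval L x)"
    using building_set_iso[OF assms X] by blast
  then have "bij_betw \<phi> {\<lambda>_. undefined} (lower_interval L x)"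
    unfolding poset_iso_def by simp
  then have "lower_interval L x = {\<phi> (\<lambda>_. undefined)}"
    unfolding bij_betw_def by simp
  moreover have "x \<in> lower_interval L x" "z \<in> lower_interval L x"
    unfolding lower_interval_def using assms z by auto
  ultimately show False
    using assms(2) by simp
qed

text \<open>If some \<open>u < y\<close> bounded the elements of \<open>S\<close> below \<open>y\<close>, then lowering the
  \<open>y\<close>-coordinate of the top of the product to that of \<open>u\<close> would give an upper bound of \<open>S\<close>
  strictly below \<open>j\<close>.\<close>

lemma factor_is_join:
  assumes S: "S \<subseteq> \<G>" and j: "is_join L S j" "j \<noteq> z"
    and y: "y \<in> maximal_elements {g \<in> \<G>. g \<le> j}"
  shows "is_join L {s \<in> S. s \<le> y} y"
proof -
  define X where "X = maximal_elements {g \<in> \<G>. g \<le> j}"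
  define P where "P = (\<Pi>\<^sub>E y\<in>X. lower_interval L y)"
  define e where "e y = (\<lambda>w\<in>X. if w = y then y else z)" for y
  have jL: "j \<in> L"
    using j is_join_def by blast
  obtain \<phi> where \<phi>: "poset_iso \<phi> P (lower_interval L j)" "\<And>y. y \<in> X \<Longrightarrow> \<phi> (e y) = y"
    unfolding P_def e_def using building_set_iso[OF jL j(2) X_def] by blast
  have X: "w \<in> L" "w \<le> j" if "w \<in> X" for w
    using that building_set_subset(1) unfolding X_def maximal_elements_def by blast+
  have yX: "y \<in> X"
    using y X_def by blast
  have le: "\<phi> p \<le> \<phi> q \<longleftrightarrow> p \<le> q" if "p \<in> P" "q \<in> P" for p q
    using \<phi>(1) that unfolding poset_iso_def by blast
  have into: "\<phi> p \<in> L \<and> \<phi> p \<le> j" if "p \<in> P" for p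
    using \<phi>(1) that unfolding poset_iso_def bij_betw_def lower_interval_def by blast
  have onto: "\<exists>p\<in>P. \<phi> p = u" if "u \<in> L" "u \<le> j" for u
    using \<phi>(1) that unfolding poset_iso_def bij_betw_def lower_interval_def
    by (metis (mono_tags, lifting) imageE mem_Collect_eq)
  have P_iff: "p \<in> P \<longleftrightarrow> p \<in> extensional X \<and> (\<forall>w\<in>X. p w \<in> L \<and> p w \<le> w)" for p
    unfolding P_def PiE_iff lower_interval_def by auto
  have leP: "p \<le> q \<longleftrightarrow> (\<forall>w\<in>X. p w \<le> q w)" if "p \<in> P" "q \<in> P" for p q
  proof
    assume R: "\<forall>w\<in>X. p w \<le> q w"
    show "p \<le> q"
    proof (rule le_funI)
      fix w
      show "p w \<le> q w"
        using R that unfolding P_iff extensional_def by (cases "w \<in> X") auto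
    qed
  qed (simp add: le_funD)
  have eP: "e w \<in> P" if "w \<in> X" for w
    unfolding P_iff e_def using that X z by auto
  \<comment> \<open>The top of the product, which \<phi> sends to the top \<open>j\<close> of the
    interval.\<close>
  define T where "T = (\<lambda>w\<in>X. w)"
  have TP: "T \<in> P"
    unfolding P_iff T_def using X by auto
  have leT: "p \<le> T" if "p \<in> P" for p
    unfolding leP[OF that TP] using that unfolding P_iff T_def by auto
  have \<phi>T: "\<phi> T = j"
  proof -
    obtain p where "p \<in> P" "\<phi> p = j"
      using onto jL by blast
    then have "j \<le> \<phi> T"
      using leT le TP by blast
    then show ?thesis
      using into[OF TP] by (simp add: order_antisym)
  qed
  have upper: "u = y" if u: "u \<in> L" "u \<le> y" "\<And>s. s \<in> S \<Longrightarrow> s \<le> y \<Longrightarrow> s \<le> u" for u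
  proof (rule ccontr)
    assume "u \<noteq> y"
    obtain p where p: "p \<in> P" "\<phi> p = u"
      using onto u X[OF yX] order_trans by blast
    have p_le: "p \<le> e y"
      using le[OF p(1) eP[OF yX]] p u \<phi>(2)[OF yX] by simp
    have "p \<noteq> e y"
      using p(2) \<phi>(2)[OF yX] \<open>u \<noteq> y\<close> by blast
    have "p y \<noteq> y"
    proof
      assume "p y = y"
      then have "e y \<le> p"
        unfolding leP[OF eP[OF yX] p(1)] using p(1) z unfolding e_def P_iff by auto
      then show False
        using p_le \<open>p \<noteq> e y\<close> by (simp add: order_antisym)
    qed
    define q where "q = T(y := p y)"
    have qP: "q \<in> P"
      using TP p(1) yX unfolding P_iff q_def by (auto simp: extensional_def)
    \<comment> \<open>Each \<open>s\<close> lies below some factor \<open>w\<close>. If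
      \<open>w = y\<close>, it lies below \<open>u\<close>, the image of \<open>p \<le> q\<close>;
      if not, lowering coordinate \<open>y\<close> leaves coordinate \<open>w\<close> at its top, so
      \<open>e w \<le> q\<close>.\<close>
    have "s \<le> \<phi> q" if "s \<in> S" for s
    proof -
      have "s \<in> {g \<in> \<G>. g \<le> j}"
        using that S j is_join_def by blast
      moreover have "finite {g \<in> \<G>. g \<le> j}"
        using finite_L building_set_subset(1) finite_subset by fastforce
      ultimately obtain w where w: "w \<in> X" "s \<le> w"
        using maximal_above X_def by blast
      show ?thesis
      proof (cases "w = y")
        case True
        have "p \<le> q"
          unfolding leP[OF p(1) qP] using p(1) unfolding q_def T_def P_iff by auto
        then have "u \<le> \<phi> q"
          using le p qP by blast
        then show ?thesis
          using u(3)[OF that] w True by (meson order_trans)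
      next
        case False
        have "e w \<le> q"
          unfolding leP[OF eP[OF w(1)] qP]
          using p(1) yX False z X unfolding e_def q_def T_def P_iff by auto
        then have "w \<le> \<phi> q"
          using le[OF eP[OF w(1)] qP] \<phi>(2)[OF w(1)] by simp
        then show ?thesis
          using w(2) by (meson order_trans)
      qed
    qed
    then have "\<phi> T \<le> \<phi> q"
      using j(1) into[OF qP] \<phi>T unfolding is_join_def by blast
    then have "T y \<le> q y"
      using le[OF TP qP] le_funD by metis
    then have "y \<le> p y"
      using yX unfolding T_def q_def by simp
    then show False
      using p(1) yX \<open>p y \<noteq> y\<close> unfolding P_iff by (simp add: order_antisym)
  qed
  show ?thesis
    unfolding is_join_def
  proof (intro conjI ballI impI)
    fix u assume u: "u \<in> L" "\<forall>a\<in>{s \<in> S. s \<le> y}. a \<le> u"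
    \<comment> \<open>An arbitrary upper bound need not lie below \<open>y\<close>, as
      \<open>upper\<close> requires; its meet with \<open>y\<close> does.\<close>
    have "inf u y = y"
      by (rule upper) (use u inf_closed X yX in auto)
    then show "y \<le> u"
      by (metis inf_le1)
  qed (use X yX in auto)
qed

text \<open>An element of \<G> below the join lies below some factor \<open>y\<close>. By
  \<open>factor_is_join\<close>, \<open>y\<close> is the join of the members of \<open>N\<close>
  below it, and being in \<G> it must be one of them by \<open>nested_set_join_mem\<close>.\<close>

lemma nested_set_join:
  assumes N: "nested_set L \<G> N"
  shows "\<exists>j. is_join L N j \<and> (\<forall>g\<in>\<G>. g \<le> j \<longrightarrow> (\<exists>s\<in>N. g \<le> s))"
proof -
  obtain j where j: "is_join L N j"
    using nested_set_join_ex building_set_subset(1) finite_L z N by blast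
  have NG: "N \<subseteq> \<G>"
    using N nested_set_def by blast
  have finG: "finite \<G>"
    using finite_L building_set_subset(1) finite_subset by blast
  have "\<exists>s\<in>N. g \<le> s" if g: "g \<in> \<G>" "g \<le> j" for g
  proof -
    obtain y where y: "y \<in> maximal_elements {g \<in> \<G>. g \<le> j}" "g \<le> y"
      using maximal_above[of "{g \<in> \<G>. g \<le> j}" g] g finG by auto
    then have yG: "y \<in> \<G>" "y \<in> L"
      using building_set_subset(1) unfolding maximal_elements_def by auto
    have "j \<noteq> z"
      using g building_set_subset z by (metis order_antisym subsetD)
    then have join: "is_join L {s \<in> N. s \<le> y} y"
      using factor_is_join NG j y(1) by blast
    have ne: "{s \<in> N. s \<le> y} \<noteq> {}"
    proof
      assume "{s \<in> N. s \<le> y} = {}"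
      then have "y \<le> z"
        using join z(1) unfolding is_join_def by (metis empty_iff)
      then show False
        using order_antisym[OF _ z(2)[OF yG(2)]] yG(1) building_set_subset(2) by simp
    qed
    have fin: "finite {s \<in> N. s \<le> y}"
      by (rule finite_subset[OF _ finG]) (use NG in auto)
    have "y \<in> {s \<in> N. s \<le> y}"
      by (rule nested_set_join_mem[OF building_set_subset(1) N _ fin ne join yG(1)]) simp
    with y(2) show ?thesis
      by blast
  qed
  with j show ?thesis
    by blast
qed

lemma blowup_pairs_building_set:
  assumes Gs: "set Gs = \<G>" "distinct Gs"
    and non_increasing:
      "\<And>i j. i < length Gs \<Longrightarrow> j < length Gs \<Longrightarrow> Gs ! j < Gs ! i \<Longrightarrow> i < j"
  shows "blowup_pairs L Gs = (\<lambda>N. (N, z)) ` nested_complex L \<G>"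
proof (intro equalityI subsetI)
  fix p assume "p \<in> blowup_pairs L Gs"
  then obtain N s where p: "p = (N, s)" and N: "N \<subseteq> \<G>" and s: "s \<in> L"
    and ub: "\<exists>u\<in>L. s \<le> u \<and> (\<forall>g\<in>N. g \<le> u)"
    and after: "\<And>l. l < length Gs \<Longrightarrow> \<exists>u\<in>L. s \<le> u \<and> \<not> Gs ! l \<le> u \<and>
        (\<forall>m. l < m \<longrightarrow> m < length Gs \<longrightarrow> Gs ! m \<in> N \<longrightarrow> Gs ! m \<le> u)"
    unfolding blowup_pairs_def Gs(1) by auto
  \<comment> \<open>A larger \<open>s\<close> would be above some \<open>Gs ! l\<close>, and so
    would every candidate \<open>u\<close> at index \<open>l\<close>.\<close>
  have "s = z"
  proof (rule ccontr)
    assume "s \<noteq> z"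
    then obtain l where "l < length Gs" "Gs ! l \<le> s"
      using building_set_below s Gs(1) by (metis in_set_conv_nth)
    then show False
      using after order_trans by blast
  qed
  moreover have "nested_set L \<G> N"
    unfolding nested_set_def
  proof (intro conjI allI impI N)
    fix A assume A: "A \<subseteq> N" "finite A \<and> card A \<ge> 2 \<and> pairwise (\<lambda>x y. \<not> x \<le> y) A"
    obtain u where "u \<in> L" "\<forall>a\<in>A. a \<le> u"
      using ub A(1) by blast
    then obtain j where j: "is_join L A j"
      using finite_inf_closed_join[OF finite_L inf_closed] by blast
    have "j \<notin> \<G>"
    proof
      assume "j \<in> \<G>"
      then obtain k where k: "k < length Gs" "Gs ! k = j"
        using Gs(1) by (metis in_set_conv_nth)
      \<comment> \<open>An antichain with two or more elements does not contain its join, so all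
        members of \<open>A\<close> are strictly below \<open>j\<close> and are listed after it. The
        condition at index \<open>k\<close> then yields an upper bound of \<open>A\<close> that is
        not above \<open>j\<close>.\<close>
      have later: "k < m" if m: "m < length Gs" "Gs ! m \<in> A" for m
      proof -
        obtain b where b: "b \<in> A" "b \<noteq> Gs ! m"
          using A(2) m(2) by (metis card_2_iff' card_le_Suc0_iff_eq not_less_eq_eq numeral_2_eq_2)
        then have "\<not> b \<le> Gs ! m"
          using A(2) m(2) unfolding pairwise_def by blast
        then have "Gs ! m < j"
          using j b m unfolding is_join_def by (metis order_le_less)
        then show ?thesis
          using non_increasing k m by blast
      qed
      obtain v where v: "v \<in> L" "\<not> Gs ! k \<le> v"
          "\<And>m. k < m \<Longrightarrow> m < length Gs \<Longrightarrow> Gs ! m \<in> N \<Longrightarrow> Gs ! m \<le> v"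
        using after[OF k(1)] by blast
      have "a \<le> v" if "a \<in> A" for a
      proof -
        have "a \<in> set Gs"
          using A(1) N Gs(1) that by blast
        then obtain m where "m < length Gs" "Gs ! m = a"
          by (auto simp: in_set_conv_nth)
        then show ?thesis
          using v(3)[of m] later[of m] that A(1) by blast
      qed
      then have "j \<le> v"
        using j v(1) unfolding is_join_def by blast
      then show False
        using k v(2) by blast
    qed
    with j show "\<exists>j. is_join L A j \<and> j \<notin> \<G>"
      by blast
  qed
  ultimately show "p \<in> (\<lambda>N. (N, z)) ` nested_complex L \<G>"
    using p nested_complex_def by blast
next
  fix p assume "p \<in> (\<lambda>N. (N, z)) ` nested_complex L \<G>"
  then obtain N where p: "p = (N, z)" and N: "nested_set L \<G> N"
    unfolding nested_complex_def by blast
  show "p \<in> blowup_pairs L Gs"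
    unfolding p blowup_pairs_def
  proof (intro CollectI case_prodI conjI allI impI z)
    show "N \<subseteq> set Gs"
      using N Gs(1) nested_set_def by blast
    obtain j where "is_join L N j"
      using nested_set_join[OF N] by blast
    then show "\<exists>u\<in>L. z \<le> u \<and> (\<forall>g\<in>N. g \<le> u)"
      using z(2) unfolding is_join_def by blast
    fix l assume l: "l < length Gs"
    \<comment> \<open>The join of these later members is the required \<open>u\<close>: were it
      above \<open>Gs ! l\<close>, some later member would be strictly above \<open>Gs ! l\<close>,
      against the order of the list.\<close>
    define T where "T = {Gs ! m |m. l < m \<and> m < length Gs \<and> Gs ! m \<in> N}"
    have "nested_set L \<G> T"
      by (rule nested_set_subset[OF N]) (auto simp: T_def)
    then obtain j where j: "is_join L T j" "\<forall>g\<in>\<G>. g \<le> j \<longrightarrow> (\<exists>s\<in>T. g \<le> s)"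
      using nested_set_join by blast
    have "\<not> Gs ! l \<le> j"
    proof
      assume "Gs ! l \<le> j"
      then obtain m where m: "l < m" "m < length Gs" "Gs ! l \<le> Gs ! m"
        using j(2) l Gs(1) nth_mem unfolding T_def by blast
      moreover have "Gs ! l \<noteq> Gs ! m"
        using m(1,2) l Gs(2) by (simp add: nth_eq_iff_index_eq)
      ultimately show False
        using non_increasing[OF m(2) l] by (simp add: less_le)
    qed
    then show "\<exists>u\<in>L. z \<le> u \<and> \<not> Gs ! l \<le> u \<and>
        (\<forall>m. l < m \<longrightarrow> m < length Gs \<longrightarrow> Gs ! m \<in> N \<longrightarrow> Gs ! m \<le> u)"
      using j(1) z(2) unfolding is_join_def T_def by blast
  qed
qed

end

section \<open>Iterated stellar subdivisions\<close>

lemma poset_iso_inv: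
  assumes "poset_iso f P Q"
  shows "poset_iso (inv_into P f) Q P"
proof -
  have f: "bij_betw f P Q" "\<And>x y. x \<in> P \<Longrightarrow> y \<in> P \<Longrightarrow> x \<le> y \<longleftrightarrow> f x \<le> f y"
    using assms unfolding poset_iso_def by auto
  have g: "inv_into P f y \<in> P" "f (inv_into P f y) = y" if "y \<in> Q" for y
    using f(1) that bij_betw_inv_into_right bij_betw_imp_surj_on inv_into_into by metis+
  show ?thesis
    unfolding poset_iso_def using f g bij_betw_inv_into by simp
qed

section \<open>Cones of the iterated subdivision as combinatorial pairs\<close>

definition blowup_cone :: "('a::euclidean_space set \<Rightarrow> 'a) \<Rightarrow> 'a set set \<times> 'a set \<Rightarrow> 'a set" where
  "blowup_cone x p = convex_cone hull (x ` fst p \<union> snd p)"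

lemma blowup_cone_empty: "convex_cone s \<Longrightarrow> blowup_cone x ({}, s) = s"
  unfolding blowup_cone_def by (simp add: hull_same)

lemma blowup_cone_insert:
  "blowup_cone x (insert G N, s) = convex_cone hull (insert (x G) (blowup_cone x (N, s)))"
  unfolding blowup_cone_def
  using hull_Un_right[of convex_cone "{x G}" "x ` N \<union> s"] by simp

lemma iterated_stellar_snoc:
  "iterated_stellar x \<Sigma> (Gs @ [G]) = stellar_subdivision (iterated_stellar x \<Sigma> Gs) G (x G)"
  unfolding iterated_stellar_def by simp

lemma fan_subdivision_trans:
  "fan_subdivision \<Sigma>'' \<Sigma>' \<Longrightarrow> fan_subdivision \<Sigma>' \<Sigma> \<Longrightarrow> fan_subdivision \<Sigma>'' \<Sigma>"
  unfolding fan_subdivision_def by (metis order_trans)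

text \<open>A listed cone inside \<open>G\<close> would have to come after \<open>G\<close>, so
  \<open>u = G\<close> meets every condition. Hence \<open>G\<close> is still a cone of the current
  fan when its turn comes.\<close>

lemma last_in_blowup_pairs:
  assumes G: "G \<in> \<Sigma>" "distinct (Gs @ [G])"
    and non_increasing: "\<And>i j. i < Suc (length Gs) \<Longrightarrow> j < Suc (length Gs) \<Longrightarrow>
      (Gs @ [G]) ! j \<subset> (Gs @ [G]) ! i \<Longrightarrow> i < j"
  shows "({}, G) \<in> blowup_pairs \<Sigma> Gs"
proof -
  have "\<not> Gs ! l \<subseteq> G" if l: "l < length Gs" for l
  proof
    assume "Gs ! l \<subseteq> G"
    moreover have "Gs ! l \<noteq> G"
      using l G(2) nth_mem by fastforce
    ultimately have "(Gs @ [G]) ! l \<subset> (Gs @ [G]) ! length Gs"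
      using l by (auto simp: nth_append)
    then show False
      using non_increasing[of "length Gs" l] l by simp
  qed
  then show ?thesis
    using G(1) unfolding blowup_pairs_def by auto
qed

text \<open>The claims are carried through the induction together: the subdivision claim provides
  the fan for the next step, and the order claim lets its star and link be read off from pairs.
  Simpliciality is restricted to pairs over \<open>{0}\<close>, since the cones of \<Sigma>
  themselves need not be simplicial.\<close>

lemma iterated_stellar_blowup:
  fixes \<Sigma> :: "'a::euclidean_space set set"
  assumes fan: "polyhedral_fan \<Sigma>"
    and "distinct Gs" "set Gs \<subseteq> \<Sigma> - {{0}}"
    and "\<And>i j. i < length Gs \<Longrightarrow> j < length Gs \<Longrightarrow> Gs ! j \<subset> Gs ! i \<Longrightarrow> i < j"
    and "\<And>G. G \<in> set Gs \<Longrightarrow> x G \<in> rel_interior G"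
  shows "fan_subdivision (iterated_stellar x \<Sigma> Gs) \<Sigma> \<and>
    iterated_stellar x \<Sigma> Gs = blowup_cone x ` blowup_pairs \<Sigma> Gs \<and>
    (\<forall>p\<in>blowup_pairs \<Sigma> Gs. \<forall>q\<in>blowup_pairs \<Sigma> Gs.
      blowup_cone x p \<subseteq> blowup_cone x q \<longleftrightarrow> fst p \<subseteq> fst q \<and> snd p \<subseteq> snd q) \<and>
    (\<forall>N. (N, {0}) \<in> blowup_pairs \<Sigma> Gs \<longrightarrow> simplicial_cone (blowup_cone x (N, {0})))"
  using assms(2-)
proof (induction Gs rule: rev_induct)
  case Nil
  have "simplicial_cone {0 :: 'a}"
    unfolding simplicial_cone_def by (intro exI[of _ "{}"]) (simp add: independent_empty)
  moreover have "fan_subdivision \<Sigma> \<Sigma>"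
    unfolding fan_subdivision_def using fan by blast
  ultimately show ?case
    using blowup_cone_empty[OF fan_cone(2)[OF fan]]
    by (auto simp: blowup_pairs_Nil iterated_stellar_def image_image blowup_cone_empty)
next
  case (snoc G Gs)
  define \<Delta> where "\<Delta> = iterated_stellar x \<Sigma> Gs"
  define A where "A = blowup_pairs \<Sigma> Gs"
  define K where "K = blowup_cone x"
  have prems: "distinct Gs" "set Gs \<subseteq> \<Sigma> - {{0}}" "\<And>G. G \<in> set Gs \<Longrightarrow> x G \<in> rel_interior G"
    using snoc.prems(1,2,4) by simp_all
  have non_increasing: "i < j" if "i < length Gs" "j < length Gs" "Gs ! j \<subset> Gs ! i" for i j
    using snoc.prems(3)[of i j] that by (simp add: nth_append)
  have IH: "fan_subdivision \<Delta> \<Sigma>" "\<Delta> = K ` A"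
      "\<And>p q. p \<in> A \<Longrightarrow> q \<in> A \<Longrightarrow> K p \<subseteq> K q \<longleftrightarrow> fst p \<subseteq> fst q \<and> snd p \<subseteq> snd q"
      "\<And>N. (N, {0}) \<in> A \<Longrightarrow> simplicial_cone (K (N, {0}))"
    using snoc.IH[OF prems(1,2) non_increasing prems(3), folded \<Delta>_def A_def K_def] by blast+
  have G: "G \<in> \<Sigma>" "G \<noteq> {0}" "G \<notin> set Gs" "x G \<in> rel_interior G"
    using snoc.prems by auto
  have GA: "({}, G) \<in> A" and KG: "K ({}, G) = G"
    using last_in_blowup_pairs[OF G(1) snoc.prems(1)] snoc.prems(3)
      blowup_cone_empty[OF fan_cone(2)[OF fan G(1)]] unfolding A_def K_def by auto
  have "G \<in> \<Delta>"
    using GA KG IH(2) by blast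
  then interpret stellar \<Delta> G "x G"
    using IH(1) G unfolding fan_subdivision_def by unfold_locales auto
  have down: "(N', s') \<in> A" if "(N, s) \<in> A" "N' \<subseteq> N" "s' \<subseteq> s" "s' \<in> \<Sigma>" for N s N' s'
    using blowup_pairs_down that unfolding A_def by blast
  have A_fst: "G \<notin> fst p" if "p \<in> A" for p
    using that G(3) unfolding A_def blowup_pairs_def by auto
  have A_snd: "s \<in> \<Sigma>" if "(N, s) \<in> A" for N s
    using that unfolding A_def blowup_pairs_def by auto
  have G_le: "G \<subseteq> K p \<longleftrightarrow> G \<subseteq> snd p" if "p \<in> A" for p
    using IH(3)[OF GA that] KG by simp
  have old: "K p \<in> old \<longleftrightarrow> \<not> G \<subseteq> snd p" if "p \<in> A" for p
    using G_le[OF that] that IH(2) unfolding old_def fan_star_def by blast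
  have link: "K (N, s) \<in> link \<longleftrightarrow> \<not> G \<subseteq> s \<and> (\<exists>s'. (N, s') \<in> A \<and> s \<subseteq> s' \<and> G \<subseteq> s')"
    if Ns: "(N, s) \<in> A" for N s
  proof -
    have "(\<exists>\<sigma>\<in>fan_star G \<Delta>. K (N, s) \<subseteq> \<sigma>) \<longleftrightarrow> (\<exists>q\<in>A. G \<subseteq> K q \<and> K (N, s) \<subseteq> K q)"
      unfolding fan_star_def IH(2) by blast
    also have "\<dots> \<longleftrightarrow> (\<exists>q\<in>A. G \<subseteq> snd q \<and> N \<subseteq> fst q \<and> s \<subseteq> snd q)"
      using G_le IH(3)[OF Ns] by (auto intro!: bex_cong)
    \<comment> \<open>A star cone above \<open>K (N, s)\<close> may carry a larger first component;
      downward closure of \<open>A\<close> cuts it back to \<open>N\<close>.\<close>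
    also have "\<dots> \<longleftrightarrow> (\<exists>s'. (N, s') \<in> A \<and> s \<subseteq> s' \<and> G \<subseteq> s')"
    proof
      assume "\<exists>q\<in>A. G \<subseteq> snd q \<and> N \<subseteq> fst q \<and> s \<subseteq> snd q"
      then obtain M s' where q: "(M, s') \<in> A" "G \<subseteq> s'" "N \<subseteq> M" "s \<subseteq> s'"
        by auto
      then have "(N, s') \<in> A"
        using down[OF q(1,3) order_refl A_snd[OF q(1)]] by simp
      with q show "\<exists>s'. (N, s') \<in> A \<and> s \<subseteq> s' \<and> G \<subseteq> s'"
        by blast
    qed force
    finally show ?thesis
      using old[OF Ns] unfolding link_def by auto
  qed
  \<comment> \<open>\<open>B\<close> indexes the old cones, \<open>C\<close> the link, and
    \<open>e\<close> mirrors \<open>ext\<close> on pairs.\<close>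
  define B where "B = {p \<in> A. \<not> G \<subseteq> snd p}"
  define C where "C = {(N, s). (N, s) \<in> A \<and> K (N, s) \<in> link}"
  define e where "e p = (insert G (fst p), snd p)" for p :: "'a set set \<times> 'a set"
  have pairs: "blowup_pairs \<Sigma> (Gs @ [G]) = B \<union> e ` C"
  proof -
    have "finite \<Sigma>" "\<And>a b. a \<in> \<Sigma> \<Longrightarrow> b \<in> \<Sigma> \<Longrightarrow> inf a b \<in> \<Sigma>"
      using assms(1) fan_Int[OF assms(1)] by (auto simp: polyhedral_fan_def)
    note blowup = blowup_pairs_snoc[OF this G(1,3), folded A_def, folded B_def]
    have C_iff: "(N, s) \<in> A \<and> \<not> G \<subseteq> s \<and> (\<exists>s'. (N, s') \<in> A \<and> s \<subseteq> s' \<and> G \<subseteq> s') \<longleftrightarrow> (N, s) \<in> C" for N s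
      unfolding C_def using link[of N s] by auto
    have "e ` C = {(insert G N, s) |N s. (N, s) \<in> C}"
      unfolding e_def by (auto simp: image_iff Bex_def)
    with blowup show ?thesis
      unfolding C_iff by simp
  qed
  have e_proj: "fst (e p) = insert G (fst p)" "snd (e p) = snd p" for p
    by (simp_all add: e_def)
  have Ke: "K (e p) = ext (K p)" for p
    unfolding K_def e_def ext_def by (cases p) (simp add: blowup_cone_insert)
  have "iterated_stellar x \<Sigma> (Gs @ [G]) = old \<union> ext ` link"
    unfolding iterated_stellar_snoc \<Delta>_def[symmetric] by (rule stellar_subdivision_eq)
  also have "old = K ` B"
    using old IH(2) unfolding B_def old_def by blast
  also have "link = K ` C"
    using link_fan IH(2) unfolding C_def by force
  finally have image: "iterated_stellar x \<Sigma> (Gs @ [G]) = K ` (B \<union> e ` C)"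
    by (simp add: image_Un image_image Ke)
  have BA: "p \<in> A" "K p \<in> old" "G \<notin> fst p" if "p \<in> B" for p
    using that old A_fst unfolding B_def by auto
  have CA: "p \<in> A" "K p \<in> link" "G \<notin> fst p" if "p \<in> C" for p
    using that A_fst unfolding C_def by auto
  have order: "K p \<subseteq> K q \<longleftrightarrow> fst p \<subseteq> fst q \<and> snd p \<subseteq> snd q"
    if pq: "p \<in> B \<union> e ` C" "q \<in> B \<union> e ` C" for p q
  proof -
    \<comment> \<open>Membership of \<open>G\<close> in the first component separates new cones from
      old ones, so inclusion of pairs follows the three comparison lemmas of a single step.\<close>
    consider "p \<in> B" "q \<in> B" | q' where "p \<in> B" "q = e q'" "q' \<in> C"
      | p' where "p = e p'" "p' \<in> C" "q \<in> B" | p' q' where "p = e p'" "p' \<in> C" "q = e q'" "q' \<in> C"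
      using pq by blast
    then show ?thesis
    proof cases
      case 1
      then show ?thesis
        using IH(3) BA by blast
    next
      case 2
      then show ?thesis
        using old_subset_ext_iff[OF CA(2)[OF 2(3)] BA(2)[OF 2(1)]]
          IH(3)[OF BA(1)[OF 2(1)] CA(1)[OF 2(3)]] BA(3)[OF 2(1)]
        by (simp add: Ke e_proj subset_insert)
    next
      case 3
      then show ?thesis
        using ext_not_subset_old[OF BA(2)[OF 3(3)]] BA(3)[OF 3(3)] by (simp add: Ke e_proj)
    next
      case 4
      then show ?thesis
        using ext_subset_ext_iff[OF CA(2)[OF 4(2)] CA(2)[OF 4(4)]]
          IH(3)[OF CA(1)[OF 4(2)] CA(1)[OF 4(4)]] CA(3)[OF 4(2)]
        by (simp add: Ke e_proj subset_insert)
    qed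
  qed
  have simplicial: "simplicial_cone (K (N, {0}))" if N: "(N, {0}) \<in> B \<union> e ` C" for N
  proof (cases "(N, {0}) \<in> B")
    case True
    then show ?thesis
      using IH(4) BA(1) by blast
  next
    case False
    then obtain p where p: "(N, {0}) = e p" "p \<in> C"
      using N by blast
    \<comment> \<open>Since \<open>e\<close> keeps the second component, the base cone is covered by
      the induction hypothesis.\<close>
    then have "snd p = {0}"
      unfolding e_def by simp
    then have "simplicial_cone (K p)"
      using IH(4) CA(1)[OF p(2)] by (metis prod.collapse)
    moreover obtain a where "cone_extension (K p) (x G) a"
      using link_extension[OF CA(2)[OF p(2)]] .
    ultimately show ?thesis
      unfolding p(1) Ke ext_def by (intro cone_extension.simplicial_cone_extension)
  qed
  have "fan_subdivision (iterated_stellar x \<Sigma> (Gs @ [G])) \<Sigma>"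
    unfolding iterated_stellar_snoc \<Delta>_def[symmetric]
    using fan_subdivision_stellar IH(1) fan_subdivision_trans by blast
  then show ?case
    unfolding pairs K_def[symmetric] by (intro conjI ballI allI impI image order simplicial)
qed

text \<open>\<open>stellar_subdivision\<close> is a total operation; the first conjunct certifies
  that each step is a genuine one, performed on a fan that contains the cone to be
  subdivided.\<close>

theorem theorem2p5p3:
  fixes \<Sigma> \<G> :: "'a::euclidean_space set set"
    and Gs :: "'a set list"
    and x :: "'a set \<Rightarrow> 'a"
  assumes fan: "polyhedral_fan \<Sigma>"
    and building: "building_set \<Sigma> \<G>"
    and enumeration: "set Gs = \<G>" "distinct Gs"
    and non_increasing:
      "\<And>i j. i < length Gs \<Longrightarrow> j < length Gs \<Longrightarrow> Gs ! j \<subset> Gs ! i \<Longrightarrow> i < j"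
    and points: "\<And>G. G \<in> \<G> \<Longrightarrow> x G \<in> rel_interior G"
  shows "(\<forall>i<length Gs. polyhedral_fan (iterated_stellar x \<Sigma> (take i Gs)) \<and>
            Gs ! i \<in> iterated_stellar x \<Sigma> (take i Gs)) \<and>
         simplicial_subdivision (iterated_stellar x \<Sigma> Gs) \<Sigma> \<and>
         (\<exists>f. poset_iso f (iterated_stellar x \<Sigma> Gs) (nested_complex \<Sigma> \<G>))"
proof (intro conjI allI impI)
  have fan_inf: "finite \<Sigma>" "\<And>a b. a \<in> \<Sigma> \<Longrightarrow> b \<in> \<Sigma> \<Longrightarrow> inf a b \<in> \<Sigma>"
      "{0} \<in> \<Sigma>" "\<And>s. s \<in> \<Sigma> \<Longrightarrow> {0} \<le> s"
    using fan fan_Int[OF fan] fan_zero_le[OF fan] by (auto simp: polyhedral_fan_def)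
  have \<G>: "\<G> \<subseteq> \<Sigma> - {{0}}"
    using building_set_subset[OF fan_inf building] by blast
  \<comment> \<open>Every initial segment is needed here, as the first conjunct concerns the
    intermediate fans.\<close>
  have initial: "fan_subdivision (iterated_stellar x \<Sigma> (take i Gs)) \<Sigma> \<and>
      iterated_stellar x \<Sigma> (take i Gs) = blowup_cone x ` blowup_pairs \<Sigma> (take i Gs) \<and>
      (\<forall>p\<in>blowup_pairs \<Sigma> (take i Gs). \<forall>q\<in>blowup_pairs \<Sigma> (take i Gs).
        blowup_cone x p \<subseteq> blowup_cone x q \<longleftrightarrow> fst p \<subseteq> fst q \<and> snd p \<subseteq> snd q) \<and>
      (\<forall>N. (N, {0}) \<in> blowup_pairs \<Sigma> (take i Gs) \<longrightarrow> simplicial_cone (blowup_cone x (N, {0})))" for i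
  proof (rule iterated_stellar_blowup[OF fan])
    show "set (take i Gs) \<subseteq> \<Sigma> - {{0}}"
      using \<G> enumeration(1) set_take_subset[of i Gs] by simp
    show "x G \<in> rel_interior G" if "G \<in> set (take i Gs)" for G
      using points enumeration(1) in_set_takeD[OF that] by simp
  qed (use enumeration(2) non_increasing in auto)
  {
    fix i assume i: "i < length Gs"
    show "polyhedral_fan (iterated_stellar x \<Sigma> (take i Gs))"
      using initial fan_subdivision_def by blast
    have G: "Gs ! i \<in> \<Sigma>"
      using i \<G> enumeration(1) nth_mem by blast
    have snoc: "take i Gs @ [Gs ! i] = take (Suc i) Gs"
      using i by (simp add: take_Suc_conv_app_nth)
    have "({}, Gs ! i) \<in> blowup_pairs \<Sigma> (take i Gs)"
      by (rule last_in_blowup_pairs[OF G])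
        (use i enumeration(2) non_increasing in \<open>auto simp: snoc\<close>)
    then show "Gs ! i \<in> iterated_stellar x \<Sigma> (take i Gs)"
      using initial blowup_cone_empty[OF fan_cone(2)[OF fan G]] by (metis image_eqI)
  }
  define h where "h N = blowup_cone x (N, {0})" for N
  \<comment> \<open>After the last step all second components are \<open>{0}\<close>, so inclusion
    of pairs becomes inclusion of nested sets and the claim on simplicial cones covers every
    cone.\<close>
  have pairs: "blowup_pairs \<Sigma> Gs = (\<lambda>N. (N, {0})) ` nested_complex \<Sigma> \<G>"
    using blowup_pairs_building_set[OF fan_inf building enumeration] non_increasing by blast
  have final: "fan_subdivision (iterated_stellar x \<Sigma> Gs) \<Sigma>"
      "iterated_stellar x \<Sigma> Gs = h ` nested_complex \<Sigma> \<G>"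
      "\<And>N M. N \<in> nested_complex \<Sigma> \<G> \<Longrightarrow> M \<in> nested_complex \<Sigma> \<G> \<Longrightarrow> h N \<subseteq> h M \<longleftrightarrow> N \<subseteq> M"
      "\<And>N. N \<in> nested_complex \<Sigma> \<G> \<Longrightarrow> simplicial_cone (h N)"
    using initial[of "length Gs"] unfolding pairs take_all[OF order_refl] h_def by (auto simp: image_image)
  show "simplicial_subdivision (iterated_stellar x \<Sigma> Gs) \<Sigma>"
    unfolding simplicial_subdivision_def using final by auto
  have "inj_on h (nested_complex \<Sigma> \<G>)"
    using final(3) by (intro inj_onI) (metis order_antisym order_refl)
  then have "poset_iso h (nested_complex \<Sigma> \<G>) (iterated_stellar x \<Sigma> Gs)"
    unfolding poset_iso_def bij_betw_def using final by auto
  then show "\<exists>f. poset_iso f (iterated_stellar x \<Sigma> Gs) (nested_complex \<Sigma> \<G>)"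
    using poset_iso_inv by blast
qed

end
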